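(* Let $\alpha\in(0,1)$ be an irrational bounded density number and let $\lambda\in\mathbb{R}\setminus\{0\}$. Then there exist $C>0$ and $\mu>0$ such that for all $\theta\in[0,1)$, all $E\in\Sigma_{\lambda,\alpha}$ and all $n\in\mathbb{N}$, $$\|M(\lambda,E,v^n_{\alpha,\theta})\|\le C n^{\mu}.$$
   Context: Write $\alpha=[a_1,a_2,\dots]$ for the continued fraction expansion $\alpha=1/(a_1+1/(a_2+\cdots))$; $\alpha$ is a bounded density number if $\limsup_{n\to\infty}\frac1n\sum_{j=1}^n a_j<\infty$. For $\theta\in[0,1)$ let $v_{\alpha,\theta}(n)=\chi_{[1-\alpha,1)}(n\alpha+\theta\bmod 1)$, $n\in\mathbb{Z}$, and let $v^n_{\alpha,\theta}$ be the word $v_{\alpha,\theta}(1)\dots v_{\alpha,\theta}(n)$. Let $H_{\lambda,\alpha,\theta}$ act on $\ell^2(\mathbb{Z})$ by $(Hu)(n)=u(n+1)+u(n-1)+\lambda v_{\alpha,\theta}(n)u(n)$; its spectrum is independent of $\theta$ and is denoted $\Sigma_{\lambda,\alpha}$. For $a\in\mathbb{R}$, $E\in\mathbb{C}$ let $T(\lambda,E,a)=\begin{pmatrix}E-\lambda a&-1\\1&0\end{pmatrix}$ and for a word $w=w_1\dots w_n$ over $\{0,1\}$ let $M(\lambda,E,w)=T(\lambda,E,w_n)\cdots T(\lambda,E,w_1)$. $\|\cdot\|$ is the operator norm with respect to the Euclidean norm on $\mathbb{C}^2$. *)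

theory Defs
  imports "HOL-Analysis.Analysis" "HOL-Library.Liminf_Limsup"
begin

fun gauss_iter :: "real \<Rightarrow> nat \<Rightarrow> real" where
  "gauss_iter x 0 = x"
| "gauss_iter x (Suc n) = frac (1 / gauss_iter x n)"

definition cf_digit :: "real \<Rightarrow> nat \<Rightarrow> nat" where
  "cf_digit x j = nat \<lfloor>1 / gauss_iter x (j - 1)\<rfloor>"   (* meaningful for j \<ge> 1 *)

definition bounded_density :: "real \<Rightarrow> bool" where
  "bounded_density x \<longleftrightarrow>
     limsup (\<lambda>n. ereal ((1 / real n) * (\<Sum>j=1..n. real (cf_digit x j)))) < \<infinity>"

definition sturm_pot :: "real \<Rightarrow> real \<Rightarrow> int \<Rightarrow> real" where
  "sturm_pot \<alpha> \<theta> n = (if frac (of_int n * \<alpha> + \<theta>) \<in> {1 - \<alpha> ..< 1} then 1 else 0)"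

definition sturm_word :: "real \<Rightarrow> real \<Rightarrow> nat \<Rightarrow> real list" where
  "sturm_word \<alpha> \<theta> n = map (\<lambda>k. sturm_pot \<alpha> \<theta> (int k)) [1..<n+1]"

definition transfer :: "real \<Rightarrow> complex \<Rightarrow> real \<Rightarrow> complex^2^2" where
  "transfer lam E a = vector [vector [E - complex_of_real (lam * a), -1], vector [1, 0]]"

definition transfer_word :: "real \<Rightarrow> complex \<Rightarrow> real list \<Rightarrow> complex^2^2" where
  "transfer_word lam E w = foldl (\<lambda>M a. transfer lam E a ** M) (mat 1) w"

definition mat_opnorm :: "complex^2^2 \<Rightarrow> real" where
  "mat_opnorm A = onorm (\<lambda>x. A *v x)"

definition ell2 :: "(int \<Rightarrow> complex) set" where
  "ell2 = {u. (\<lambda>n. (cmod (u n))\<^sup>2) summable_on UNIV}"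

definition ell2_norm :: "(int \<Rightarrow> complex) \<Rightarrow> real" where
  "ell2_norm u = sqrt (\<Sum>\<^sub>\<infinity>n. (cmod (u n))\<^sup>2)"

definition sturm_op :: "real \<Rightarrow> real \<Rightarrow> real \<Rightarrow> (int \<Rightarrow> complex) \<Rightarrow> (int \<Rightarrow> complex)" where
  "sturm_op lam \<alpha> \<theta> u = (\<lambda>n. u (n + 1) + u (n - 1) + complex_of_real (lam * sturm_pot \<alpha> \<theta> n) * u n)"

definition op_spectrum :: "((int \<Rightarrow> complex) \<Rightarrow> (int \<Rightarrow> complex)) \<Rightarrow> complex set" where
  "op_spectrum H = {E. \<not> (\<exists>G. (\<forall>u\<in>ell2. G u \<in> ell2
        \<and> (\<lambda>n. H (G u) n - E * G u n) = u
        \<and> G (\<lambda>n. H u n - E * u n) = u)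
      \<and> (\<exists>K. \<forall>u\<in>ell2. ell2_norm (G u) \<le> K * ell2_norm u))}"

text \<open>Sigma_{lambda,alpha}; the spectrum is independent of theta, we take the union.\<close>
definition sturm_spectrum :: "real \<Rightarrow> real \<Rightarrow> complex set" where
  "sturm_spectrum lam \<alpha> = (\<Union>\<theta>\<in>{0..<1}. op_spectrum (sturm_op lam \<alpha> \<theta>))"

end

theory Submission
  imports Defs "HOL-Library.Sublist"
begin

text \<open>
  The potential codes a rotation, viewed as an exchange of two intervals. Subtracting the shorter
  interval from the longer one, again and again, is the slow Euclidean algorithm; it writes every
  finite factor of the potential as part of a concatenation of two growing blocks \<open>U\<close>, \<open>V\<close>, each
  step replacing \<open>V\<close> by \<open>UV\<close> or \<open>U\<close> by \<open>VU\<close>. One partial quotient \<open>a\<close> costs \<open>a\<close> steps, and the blocks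
  double in length every two partial quotients; under the bounded density assumption a factor of
  length \<open>n\<close> therefore sits in two blocks that are reached after \<open>O(log n)\<close> steps.

  For the transfer matrices \<open>A\<close>, \<open>B\<close> of the blocks a step is \<open>(A, B) \<mapsto> (A, BA)\<close> or \<open>(AB, B)\<close>. On the
  traces \<open>x, y, z\<close> of \<open>A, B, AB\<close> it preserves \<open>x\<^sup>2 + y\<^sup>2 + z\<^sup>2 - xyz = 4 + \<lambda>\<^sup>2\<close>. If \<open>|x|, |y| > 2\<close> and
  \<open>|z| > |x|, |y|\<close>, the same holds after every further step and for all nearby energies. Then no
  periodic approximant has spectrum near the energy, so that the energy is outside the spectrum.
  Hence on the spectrum this escape never happens, which forces the trace of the matrix \<open>W\<close> kept by
  the current step to stay bounded.

  By Cayley-Hamilton, the words in \<open>W\<close> and the other matrix \<open>L\<close> which a step creates are linear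
  combinations of \<open>1, W, L, WL, LW, WLW\<close> whose coefficients involve only the bounded traces. So each
  step multiplies the norms of all prefix products by at most a constant, and \<open>O(log n)\<close> steps give
  a power of \<open>n\<close>.
\<close>

section \<open>Unimodular two by two matrices\<close>

text \<open>The entrywise sum is submultiplicative, dominates the Euclidean operator norm
  (\<open>mat_opnorm_real\<close>) and is unchanged by inverting a unimodular matrix
  (\<open>nrm2_adj2\<close>).\<close>

definition nrm2 :: "real^2^2 \<Rightarrow> real" where
  "nrm2 A = \<bar>A$1$1\<bar> + \<bar>A$1$2\<bar> + \<bar>A$2$1\<bar> + \<bar>A$2$2\<bar>"

definition adj2 :: "real^2^2 \<Rightarrow> real^2^2" where
  "adj2 A = vector [vector [A$2$2, - A$1$2], vector [- A$2$1, A$1$1]]"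

lemma matrix_eq_2: "(A :: 'a^2^2) = B \<longleftrightarrow>
    A$1$1 = B$1$1 \<and> A$1$2 = B$1$2 \<and> A$2$1 = B$2$1 \<and> A$2$2 = B$2$2"
  by (auto simp: vec_eq_iff forall_2)

lemma mult_2_nth: "((A :: 'a::semiring_1^2^2) ** B)$i$j = A$i$1 * B$1$j + A$i$2 * B$2$j"
  by (simp add: matrix_matrix_mult_def sum_2)

lemma mat_2_nth: "(mat c :: 'a::zero^2^2)$1$1 = c" "(mat c :: 'a::zero^2^2)$1$2 = 0"
  "(mat c :: 'a::zero^2^2)$2$1 = 0" "(mat c :: 'a::zero^2^2)$2$2 = c"
  by (simp_all add: mat_def)

lemma trace_2: "trace (A :: real^2^2) = A$1$1 + A$2$2"
  by (simp add: trace_def sum_2)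

lemma nrm2_nonneg: "nrm2 A \<ge> 0"
  by (simp add: nrm2_def)

lemma nrm2_add: "nrm2 (A + B) \<le> nrm2 A + nrm2 B"
proof -
  have "nrm2 (A + B) \<le> (\<bar>A$1$1\<bar> + \<bar>B$1$1\<bar>) + (\<bar>A$1$2\<bar> + \<bar>B$1$2\<bar>)
      + (\<bar>A$2$1\<bar> + \<bar>B$2$1\<bar>) + (\<bar>A$2$2\<bar> + \<bar>B$2$2\<bar>)"
    unfolding nrm2_def vector_add_component by (intro add_mono abs_triangle_ineq)
  also have "\<dots> = nrm2 A + nrm2 B"
    unfolding nrm2_def by (simp only: ac_simps)
  finally show ?thesis .
qed

lemma nrm2_diff: "nrm2 (A - B) \<le> nrm2 A + nrm2 B"
  using nrm2_add[of A "- B"] by (simp add: nrm2_def)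

lemma nrm2_scaleR: "nrm2 (c *\<^sub>R A) = \<bar>c\<bar> * nrm2 A"
  unfolding nrm2_def by (simp add: abs_mult algebra_simps)

lemma nrm2_mult: "nrm2 (A ** B) \<le> nrm2 A * nrm2 B"
proof -
  have *: "\<bar>a * b + c * d\<bar> \<le> \<bar>a\<bar> * \<bar>b\<bar> + \<bar>c\<bar> * \<bar>d\<bar>" for a b c d :: real
    by (metis abs_mult abs_triangle_ineq)
  have "nrm2 (A ** B) \<le> (\<bar>A$1$1\<bar> * \<bar>B$1$1\<bar> + \<bar>A$1$2\<bar> * \<bar>B$2$1\<bar>) + (\<bar>A$1$1\<bar> * \<bar>B$1$2\<bar> + \<bar>A$1$2\<bar> * \<bar>B$2$2\<bar>)
      + (\<bar>A$2$1\<bar> * \<bar>B$1$1\<bar> + \<bar>A$2$2\<bar> * \<bar>B$2$1\<bar>) + (\<bar>A$2$1\<bar> * \<bar>B$1$2\<bar> + \<bar>A$2$2\<bar> * \<bar>B$2$2\<bar>)"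
    unfolding nrm2_def mult_2_nth by (intro add_mono *)
  also have "\<dots> \<le> nrm2 A * nrm2 B"
    unfolding nrm2_def by (simp add: algebra_simps)
  finally show ?thesis .
qed

lemma nrm2_adj2: "nrm2 (adj2 A) = nrm2 A"
  by (simp add: nrm2_def adj2_def vector_2)

lemma mult_adj2:
  assumes "det A = 1"
  shows "A ** adj2 A = mat 1"
proof -
  have "A$1$1 * A$2$2 - A$1$2 * A$2$1 = 1" using assms by (simp add: det_2)
  thus ?thesis
    by (simp add: matrix_eq_2 mult_2_nth mat_2_nth adj2_def vector_2 mult.commute)
qed

text \<open>Cayley-Hamilton; it reduces every repeated factor below.\<close>

lemma mult_2_square:
  assumes "det (A :: real^2^2) = 1"
  shows "A ** A = trace A *\<^sub>R A - mat 1"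
proof -
  have d: "A$1$1 * A$2$2 = 1 + A$1$2 * A$2$1" using assms by (simp add: det_2)
  show ?thesis
    using d by (simp add: matrix_eq_2 mult_2_nth mat_2_nth trace_2 algebra_simps)
qed

lemma trace_square:
  assumes "det (A :: real^2^2) = 1"
  shows "trace (A ** A) = (trace A)\<^sup>2 - 2"
  using assms by (simp add: mult_2_square trace_2 mat_2_nth power2_eq_square algebra_simps)

text \<open>By cyclicity the trace is that of \<open>A ** A ** B\<close>, and Cayley-Hamilton lowers
  the square. This is the trace map.\<close>

lemma trace_step:
  assumes "det (A :: real^2^2) = 1"
  shows "trace (A ** (B ** A)) = trace A * trace (A ** B) - trace B"
proof -
  have "A ** (B ** A) = A ** B ** A" by (simp add: matrix_mul_assoc)
  moreover have "trace (A ** B ** A) = trace ((A ** A) ** B)"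
    by (metis matrix_mul_assoc trace_mul_sym)
  ultimately show ?thesis
    unfolding mult_2_square[OF assms]
    by (simp add: trace_2 mult_2_nth mat_2_nth algebra_simps)
qed

text \<open>Cayley-Hamilton for \<open>A ** B\<close>, divided by \<open>A\<close> on the left: the
  constant term \<open>det A\<close> turns into the adjugate of \<open>A\<close>, which is its trace
  times the identity minus \<open>A\<close>.\<close>

lemma sandwich:
  assumes "det (B :: real^2^2) = 1"
  shows "B ** A ** B = A - trace A *\<^sub>R mat 1 + trace (A ** B) *\<^sub>R B"
proof -
  \<comment> \<open>Entry by entry the two sides differ by a multiple of \<open>det B - 1\<close>;
    the multipliers supplied below are the entries of \<open>- adj2 A\<close>.\<close>
  have *: "p = q" if "p - q = v * (B$1$1 * B$2$2 - B$1$2 * B$2$1 - 1)" for p q v :: real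
    using that assms by (simp add: det_2)
  show ?thesis
    unfolding matrix_eq_2 mult_2_nth mat_2_nth trace_2 vector_add_component vector_minus_component
      vector_scaleR_component real_scaleR_def
    apply (intro conjI)
       apply (rule *[of _ _ "- A$2$2"], simp add: algebra_simps)
      apply (rule *[of _ _ "A$1$2"], simp add: algebra_simps)
     apply (rule *[of _ _ "A$2$1"], simp add: algebra_simps)
    apply (rule *[of _ _ "- A$1$1"], simp add: algebra_simps)
    done
qed

text \<open>A step replaces \<open>B\<close> by \<open>B ** A\<close> and may lengthen a prefix
  product \<open>Q\<close> to \<open>Q ** A\<close>. Every product so created reduces to the old six
  by \<open>mult_2_square\<close> for \<open>A\<close>. Each reduction costs a factor 1 + c, and the
  worst case, A A B A A, takes two of them.\<close>

lemma nrm_combination_step: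
  fixes A B :: "real^2^2"
  assumes det: "det A = 1" and x: "\<bar>trace A\<bar> \<le> c" and g: "g \<ge> 0" and c: "c \<ge> 0"
  assumes b: "nrm2 Q \<le> g" "nrm2 (Q ** A) \<le> g" "nrm2 (Q ** B) \<le> g" "nrm2 (Q ** (A ** B)) \<le> g"
    "nrm2 (Q ** (B ** A)) \<le> g" "nrm2 (Q ** (A ** B ** A)) \<le> g"
  shows "\<And>P. P \<in> {Q, Q ** A} \<Longrightarrow> X \<in> {mat 1, A, B ** A, A ** (B ** A), (B ** A) ** A, A ** (B ** A) ** A}
     \<Longrightarrow> nrm2 (P ** X) \<le> (1 + c)^2 * g"
proof -
  let ?x = "trace A"
  have one: "nrm2 U \<le> (1 + c)^2 * g" if "nrm2 U \<le> (1 + c) * g" for U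
  proof -
    have "(1 + c) * g \<le> (1 + c)^2 * g"
      using c g by (intro mult_right_mono) (auto simp: power2_eq_square)
    thus ?thesis using that by linarith
  qed
  have zero: "nrm2 U \<le> (1 + c)^2 * g" if "nrm2 U \<le> g" for U
  proof (rule one)
    have "1 * g \<le> (1 + c) * g" using c g by (intro mult_right_mono) auto
    thus "nrm2 U \<le> (1 + c) * g" using that by linarith
  qed
  have lin: "nrm2 (?x *\<^sub>R U - V) \<le> (1 + c) * h" if "nrm2 U \<le> h" "nrm2 V \<le> h" for U V h
  proof -
    have "nrm2 (?x *\<^sub>R U - V) \<le> \<bar>?x\<bar> * nrm2 U + nrm2 V"
      using nrm2_diff[of "?x *\<^sub>R U" V] by (simp add: nrm2_scaleR)
    also have "\<dots> \<le> c * h + h"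
      using that x nrm2_nonneg[of U] c by (intro add_mono mult_mono) auto
    finally show ?thesis by (simp add: algebra_simps)
  qed
  have AA: "U ** A ** A = ?x *\<^sub>R (U ** A) - U" for U :: "real^2^2"
  proof -
    have "U ** A ** A = U ** (A ** A)" by (simp add: matrix_mul_assoc)
    thus ?thesis
      by (simp add: mult_2_square[OF det] matrix_eq_2 mult_2_nth mat_2_nth algebra_simps)
  qed
  have AAr: "U ** A ** A ** V = ?x *\<^sub>R (U ** A ** V) - U ** V" for U V :: "real^2^2"
    unfolding AA by (simp add: matrix_eq_2 mult_2_nth algebra_simps)
  note b = b[unfolded matrix_mul_assoc]
  have AAB: "nrm2 (Q ** A ** A ** B) \<le> (1 + c) * g"
    unfolding AAr by (rule lin[OF b(4,3)])
  have AABA: "nrm2 (Q ** A ** A ** B ** A) \<le> (1 + c) * g"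
    using lin[OF b(6,5)] unfolding AAr[of Q "B ** A", unfolded matrix_mul_assoc] .
  have AABAA: "nrm2 (Q ** A ** A ** B ** A ** A) \<le> (1 + c)^2 * g"
    unfolding AA[of "Q ** A ** A ** B"] using lin[OF AABA AAB]
    by (simp add: power2_eq_square mult.assoc)
  note rest = zero[OF b(1)] zero[OF b(2)] zero[OF b(3)] zero[OF b(4)] zero[OF b(5)] zero[OF b(6)]
    one[OF lin[OF b(5,3), folded AA]] one[OF lin[OF b(6,4), folded AA]]
    one[OF lin[OF b(2,1), folded AA]] one[OF AABA] AABAA
  show "nrm2 (P ** X) \<le> (1 + c)^2 * g"
    if "P \<in> {Q, Q ** A}" "X \<in> {mat 1, A, B ** A, A ** (B ** A), (B ** A) ** A, A ** (B ** A) ** A}" for P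
    using that rest by (elim insertE emptyE; simp only: matrix_mul_assoc matrix_mul_rid)
qed

text \<open>For the exchange of roles: the words kept for the pair (A, B) and for (B, A) differ only
  in that ABA is replaced by BAB, which \<open>sandwich\<close> expresses through controlled
  terms.\<close>

lemma nrm_switch:
  fixes A B :: "real^2^2"
  assumes det: "det B = 1" and x: "\<bar>trace A\<bar> \<le> c" and z: "\<bar>trace (A ** B)\<bar> \<le> d"
  assumes b: "nrm2 Q \<le> g" "nrm2 (Q ** A) \<le> g" "nrm2 (Q ** B) \<le> g"
  shows "nrm2 (Q ** (B ** A ** B)) \<le> (1 + c + d) * g"
proof -
  have "Q ** (B ** A ** B) = Q ** A - trace A *\<^sub>R Q + trace (A ** B) *\<^sub>R (Q ** B)"
    unfolding sandwich[OF det] by (simp add: matrix_eq_2 mult_2_nth mat_2_nth algebra_simps)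
  hence "nrm2 (Q ** (B ** A ** B)) \<le> nrm2 (Q ** A) + \<bar>trace A\<bar> * nrm2 Q + \<bar>trace (A ** B)\<bar> * nrm2 (Q ** B)"
    using nrm2_add[of "Q ** A - trace A *\<^sub>R Q" "trace (A ** B) *\<^sub>R (Q ** B)"]
      nrm2_diff[of "Q ** A" "trace A *\<^sub>R Q"] by (simp add: nrm2_scaleR)
  also have "\<dots> \<le> g + c * g + d * g"
    using b x z by (intro add_mono mult_mono) (auto simp: nrm2_nonneg)
  finally show ?thesis by (simp add: algebra_simps)
qed

section \<open>The trace map\<close>

text \<open>For unimodular matrices with traces x, y and product trace z this is the trace of the
  commutator plus 2.\<close>

definition fricke :: "real \<Rightarrow> real \<Rightarrow> real \<Rightarrow> real" where
  "fricke x y z = x\<^sup>2 + y\<^sup>2 + z\<^sup>2 - x * y * z"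

text \<open>Vieta: \<open>x * z - y\<close> is the other root of the expression read as a quadratic
  in y.\<close>

lemma fricke_step: "fricke x z (x * z - y) = fricke x y z"
  by (simp add: fricke_def power2_eq_square algebra_simps)

lemma fricke_swap: "fricke y x z = fricke x y z"
  unfolding fricke_def by algebra

definition escaping :: "real \<Rightarrow> real \<Rightarrow> real \<Rightarrow> bool" where
  "escaping x y z \<longleftrightarrow> \<bar>x\<bar> > 2 \<and> \<bar>y\<bar> > 2 \<and> \<bar>z\<bar> > \<bar>x\<bar> \<and> \<bar>z\<bar> > \<bar>y\<bar>"

lemma escaping_swap: "escaping y x z \<longleftrightarrow> escaping x y z"
  by (auto simp: escaping_def)

text \<open>The new trace satisfies |xz - y| \<ge> 2|z| - |y| > |z|.\<close>

lemma escaping_step: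
  assumes "escaping x y z"
  shows "escaping x z (x * z - y)"
proof -
  have "\<bar>x * z - y\<bar> \<ge> \<bar>x\<bar> * \<bar>z\<bar> - \<bar>y\<bar>" by (metis abs_mult abs_triangle_ineq2)
  moreover have "\<bar>x\<bar> * \<bar>z\<bar> \<ge> 2 * \<bar>z\<bar>"
    using assms by (intro mult_right_mono) (auto simp: escaping_def)
  ultimately show ?thesis using assms by (auto simp: escaping_def)
qed

text \<open>Since x^2 > 4 + I, the relation forces xyz > 0. With y^2 + z^2 \<ge> 2|yz| it becomes
  (|x| - 2)|yz| \<ge> x^2 - 4 - I, and the right side is at least (|x| - 2)(|x| + 1) as soon as |x|
  \<ge> 2 + I.\<close>

lemma large_product:
  assumes fr: "fricke x y z = 4 + I" and I: "I \<ge> 0" and x: "\<bar>x\<bar> \<ge> 3 + I"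
  shows "x * y * z > 0" "\<bar>y\<bar> * \<bar>z\<bar> \<ge> \<bar>x\<bar> + 1"
proof -
  have x2: "x\<^sup>2 \<ge> (3 + I)\<^sup>2" using x I by (metis abs_le_square_iff abs_of_nonneg add_nonneg_nonneg zero_le_numeral)
  have e: "x * y * z = x\<^sup>2 + y\<^sup>2 + z\<^sup>2 - 4 - I" using fr by (simp add: fricke_def)
  have "(3 + I)\<^sup>2 > 4 + I" using I by (simp add: power2_eq_square algebra_simps)
       (smt (verit) mult_nonneg_nonneg)
  thus pos: "x * y * z > 0"
    using e x2 zero_le_power2[of y] zero_le_power2[of z] by linarith
  have "\<bar>x\<bar> * (\<bar>y\<bar> * \<bar>z\<bar>) = x * y * z" using pos by (metis abs_mult abs_of_pos mult.assoc)
  moreover have "y\<^sup>2 + z\<^sup>2 \<ge> 2 * (\<bar>y\<bar> * \<bar>z\<bar>)"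
    using sum_squares_ge_zero[of "\<bar>y\<bar> - \<bar>z\<bar>" 0] by (simp add: power2_eq_square algebra_simps)
  ultimately have *: "(\<bar>x\<bar> - 2) * (\<bar>y\<bar> * \<bar>z\<bar>) \<ge> \<bar>x\<bar>\<^sup>2 - 4 - I"
    using e by (simp add: algebra_simps)
  have "\<bar>x\<bar>\<^sup>2 - 4 - I \<ge> (\<bar>x\<bar> - 2) * (\<bar>x\<bar> + 1)"
    using x by (simp add: power2_eq_square algebra_simps)
  with * have "(\<bar>x\<bar> - 2) * (\<bar>x\<bar> + 1) \<le> (\<bar>x\<bar> - 2) * (\<bar>y\<bar> * \<bar>z\<bar>)" by linarith
  thus "\<bar>y\<bar> * \<bar>z\<bar> \<ge> \<bar>x\<bar> + 1" using x I by (simp add: mult_le_cancel_left)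
qed

text \<open>Both y and xz - y have the sign of xz, so their absolute values add up to |xz|.\<close>

lemma next_abs:
  assumes "x * y * z > (0::real)" "x * z * (x * z - y) > 0"
  shows "\<bar>x * z - y\<bar> = \<bar>x\<bar> * \<bar>z\<bar> - \<bar>y\<bar>"
  using assms by (auto simp: abs_if abs_mult zero_less_mult_iff mult_less_0_iff split: if_splits)

text \<open>Here |x| has just exceeded R while |y| has not. If |z| > 2, then w = xz - y would exceed
  x and z in absolute value, which is an escape. So |z| \<le> 2, and \<open>large_product\<close>
  caps |x| by 2R. It also makes |w| large, so that the triple reached by keeping x twice would
  escape.\<close>

lemma excursion:
  assumes fr: "fricke x y z = 4 + I" and I: "I \<ge> 0" and R: "R \<ge> 3 + I"
    and x: "\<bar>x\<bar> > R" and y: "\<bar>y\<bar> \<le> R"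
    and k1: "\<not> escaping x y z" and k2: "\<not> escaping x z (x * z - y)"
  shows "\<bar>z\<bar> \<le> 2" "\<bar>x\<bar> \<le> 2 * R" "escaping x (x * z - y) (x * (x * z - y) - z)"
proof -
  define w where "w = x * z - y"
  have fr': "fricke x z w = 4 + I" using fr fricke_step w_def by simp
  have fr'': "fricke x w (x * w - z) = 4 + I" using fr' fricke_step by simp
  have x3: "\<bar>x\<bar> \<ge> 3 + I" using x R by simp
  note p1 = large_product[OF fr I x3]
  note p2 = large_product[OF fr' I x3]
  note p3 = large_product[OF fr'' I x3]
  have w: "\<bar>w\<bar> = \<bar>x\<bar> * \<bar>z\<bar> - \<bar>y\<bar>"
    using next_abs[OF p1(1)] p2(1) by (simp add: w_def)
  have w': "\<bar>x * w - z\<bar> = \<bar>x\<bar> * \<bar>w\<bar> - \<bar>z\<bar>"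
    using next_abs[OF p2(1) p3(1)] .
  show z2: "\<bar>z\<bar> \<le> 2"
  proof (rule ccontr)
    assume z: "\<not> \<bar>z\<bar> \<le> 2"
    have xz: "\<bar>x\<bar> * \<bar>z\<bar> \<ge> \<bar>x\<bar> * 2" using z by (intro mult_left_mono) auto
    have xz': "\<bar>x\<bar> * \<bar>z\<bar> \<ge> 3 * \<bar>z\<bar>" using x3 I by (intro mult_right_mono) auto
    have "\<bar>w\<bar> \<le> \<bar>x\<bar> \<or> \<bar>w\<bar> \<le> \<bar>z\<bar>"
      using k2 x3 I z by (auto simp: escaping_def w_def)
    then show False
    proof
      assume "\<bar>w\<bar> \<le> \<bar>x\<bar>" thus False using w xz x y by linarith
    next
      assume "\<bar>w\<bar> \<le> \<bar>z\<bar>"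
      hence "\<bar>x\<bar> * \<bar>z\<bar> \<le> \<bar>z\<bar> + R" using w y by linarith
      hence "2 * \<bar>z\<bar> \<le> R" using xz' by linarith
      moreover have "\<bar>x\<bar> * \<bar>z\<bar> > R * 2" using xz x by linarith
      ultimately show False using \<open>\<bar>x\<bar> * \<bar>z\<bar> \<le> \<bar>z\<bar> + R\<close> R I by linarith
    qed
  qed
  have "\<bar>y\<bar> * \<bar>z\<bar> \<le> R * 2" using y z2 R I by (intro mult_mono) auto
  thus "\<bar>x\<bar> \<le> 2 * R" using p1(2) by linarith
  have "\<bar>z\<bar> * \<bar>w\<bar> \<le> 2 * \<bar>w\<bar>" using z2 by (intro mult_right_mono) auto
  hence w2: "2 * \<bar>w\<bar> \<ge> \<bar>x\<bar> + 1" using p2(2) by linarith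
  have w3: "\<bar>w\<bar> > 2" using w2 x R I by linarith
  have a: "\<bar>x\<bar> * \<bar>w\<bar> \<ge> \<bar>x\<bar> * 2" using w3 by (intro mult_left_mono) auto
  have b: "\<bar>x\<bar> * \<bar>w\<bar> \<ge> 3 * \<bar>w\<bar>" using x3 I by (intro mult_right_mono) auto
  show "escaping x (x * z - y) (x * (x * z - y) - z)"
    unfolding w_def[symmetric] using w' a b x3 I z2 w2 w3 by (auto simp: escaping_def)
qed

text \<open>X, Y, Z are the traces of the kept matrix, the other one and their product. The kept
  trace can pass R only at an exchange, which moves the old one, still at most R, into Y. By
  \<open>excursion\<close> the large trace is at most 2R. Keeping it would lead to an escape, so the
  next step is an exchange again and brings in |Z| \<le> 2.\<close>

lemma bounded_excursions:
  fixes X Y Z :: "nat \<Rightarrow> real"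
  assumes Z: "\<And>t. Z (Suc t) = X t * Z t - Y t"
    and XY: "\<And>t. (X (Suc t) = X t \<and> Y (Suc t) = Z t) \<or> (X (Suc t) = Z t \<and> Y (Suc t) = X t)"
    and fr: "\<And>t. fricke (X t) (Y t) (Z t) = 4 + I" and I: "I \<ge> 0" and R: "R \<ge> 3 + I"
    and esc: "\<And>t. \<not> escaping (X t) (Y t) (Z t)"
    and init: "\<bar>X 0\<bar> \<le> R" "\<bar>Y 0\<bar> \<le> R"
  shows "\<bar>X t\<bar> \<le> 2 * R"
proof -
  \<comment> \<open>Both kinds of step lead, up to order, to the same triple.\<close>
  have next1: "\<not> escaping (X t) (Z t) (X t * Z t - Y t)" for t
    using XY[of t] esc[of "Suc t"] Z[of t] escaping_swap by metis
  have ex: "\<bar>Z t\<bar> \<le> 2" "\<bar>X t\<bar> \<le> 2 * R"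
      "escaping (X t) (X t * Z t - Y t) (X t * (X t * Z t - Y t) - Z t)"
    if "\<bar>X t\<bar> > R" "\<bar>Y t\<bar> \<le> R" for t
    using excursion[OF fr I R that esc next1] by blast+
  have "\<bar>X t\<bar> \<le> R \<or> (\<bar>X t\<bar> \<le> 2 * R \<and> \<bar>Y t\<bar> \<le> R)"
  proof (induction t)
    case 0
    show ?case using init by blast
  next
    case (Suc t)
    show ?case
    proof (cases "\<bar>X t\<bar> \<le> R")
      case True
      show ?thesis
      proof (cases "\<bar>X (Suc t)\<bar> \<le> R")
        case False
        hence "Y (Suc t) = X t" using XY[of t] True by auto
        thus ?thesis using ex(2)[of "Suc t"] False True by auto
      qed simp
    next
      case False
      hence *: "\<bar>X t\<bar> > R" "\<bar>Y t\<bar> \<le> R" using Suc by auto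
      show ?thesis
      proof (cases "X (Suc t) = Z t \<and> Y (Suc t) = X t")
        case True
        thus ?thesis using ex(1)[OF *] R I by auto
      next
        case False
        hence same: "X (Suc t) = X t" "Y (Suc t) = Z t" using XY[of t] by auto
        thus ?thesis using next1[of "Suc t"] ex(3)[OF *] Z[of t] by simp
      qed
    qed
  qed
  thus ?thesis using R I by auto
qed

text \<open>Given x and y, the third trace is a root of a monic quadratic with bounded
  coefficients.\<close>

lemma fricke_root_bound:
  assumes "fricke x y z = 4 + I" "I \<ge> 0" "\<bar>x\<bar> \<le> c" "\<bar>y\<bar> \<le> c"
  shows "\<bar>z\<bar> \<le> c\<^sup>2 + 4 + I"
proof (rule ccontr)
  assume z: "\<not> \<bar>z\<bar> \<le> c\<^sup>2 + 4 + I"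
  have "\<bar>x * y\<bar> \<le> c\<^sup>2"
    unfolding abs_mult power2_eq_square using assms by (intro mult_mono) auto
  hence "x * y * z \<le> c\<^sup>2 * \<bar>z\<bar>"
    by (metis abs_le_D1 abs_mult abs_ge_zero mult_right_mono)
  moreover have "z\<^sup>2 \<le> 4 + I + x * y * z"
    using assms(1) zero_le_power2[of x] zero_le_power2[of y] unfolding fricke_def by linarith
  ultimately have 1: "z\<^sup>2 \<le> 4 + I + c\<^sup>2 * \<bar>z\<bar>" by linarith
  have z1: "\<bar>z\<bar> > 1" using z assms(2) zero_le_power2[of c] by linarith
  have "(4 + I) * 1 < (4 + I) * \<bar>z\<bar>" using z1 assms(2) by (intro mult_strict_left_mono) auto
  moreover have "(c\<^sup>2 + 4 + I) * \<bar>z\<bar> \<le> \<bar>z\<bar> * \<bar>z\<bar>" using z by (intro mult_right_mono) auto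
  ultimately show False using 1 by (simp add: power2_eq_square algebra_simps)
qed

section \<open>Growth of prefix products\<close>

text \<open>Cayley-Hamilton would express the last two words through the first four, but with
  coefficients containing the trace of \<open>B\<close>, which may be large. They are therefore
  carried along as words of their own.\<close>

definition word_basis :: "real^2^2 \<Rightarrow> real^2^2 \<Rightarrow> (real^2^2) set" where
  "word_basis A B = {mat 1, A, B, A ** B, B ** A, A ** B ** A}"

definition nrm_bound :: "(real^2^2) set \<Rightarrow> (real^2^2) set \<Rightarrow> real \<Rightarrow> bool" where
  "nrm_bound S T g \<longleftrightarrow> (\<forall>Q\<in>S. \<forall>X\<in>T. nrm2 (Q ** X) \<le> g)"

text \<open>Prefix products and basis words are bounded together, because a step moves
  \<open>W\<close> from the words into the prefixes. Re-expanding costs (1 + c)^2, an exchange of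
  roles another 1 + c + d. The trace of \<open>W ** (L ** W)\<close> is bounded at exchanges, which
  is where it enters.\<close>

lemma nrm_growth:
  fixes W L :: "nat \<Rightarrow> real^2^2" and S :: "nat \<Rightarrow> (real^2^2) set"
  assumes WL: "\<And>t. (W (Suc t) = W t \<and> L (Suc t) = L t ** W t) \<or> (W (Suc t) = L t ** W t \<and> L (Suc t) = W t)"
    and det: "\<And>t. det (W t) = 1" "\<And>t. det (L t) = 1"
    and S: "\<And>t. S (Suc t) \<subseteq> S t \<union> (\<lambda>Q. Q ** W t) ` S t"
    and c: "\<And>t. \<bar>trace (W t)\<bar> \<le> c"
    and d: "\<And>t. W (Suc t) = L t ** W t \<Longrightarrow> \<bar>trace (W t ** (L t ** W t))\<bar> \<le> d" and d0: "d \<ge> 0"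
    and g: "nrm_bound (S 0) (word_basis (W 0) (L 0)) g" "g \<ge> 0"
  shows "nrm_bound (S t) (word_basis (W t) (L t)) (g * ((1 + c)\<^sup>2 * (1 + c + d)) ^ t)"
proof (induction t)
  case 0
  thus ?case using g by simp
next
  case (Suc t)
  let ?C = "(1 + c)\<^sup>2 * (1 + c + d)"
  let ?g = "g * ?C ^ t"
  have c0: "c \<ge> 0" using c[of 0] abs_ge_zero[of "trace (W 0)"] by linarith
  have g0: "?g \<ge> 0" using g(2) c0 d0 by (intro mult_nonneg_nonneg zero_le_power) auto
  have step: "nrm2 (P ** X) \<le> (1 + c)\<^sup>2 * ?g" if P: "P \<in> S (Suc t)" and X: "X \<in> word_basis (W t) (L t ** W t)" for P X
  proof -
    obtain Q where Q: "Q \<in> S t" "P \<in> {Q, Q ** W t}" using S[of t] P by auto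
    have b: "nrm2 (Q ** M) \<le> ?g" if "M \<in> word_basis (W t) (L t)" for M
      using Suc Q(1) that by (auto simp: nrm_bound_def)
    have Q1: "nrm2 Q \<le> ?g" using b[of "mat 1"] by (simp add: word_basis_def)
    show ?thesis
      by (rule nrm_combination_step[OF det(1) c g0 c0 Q1 b b b b b Q(2)])
         (use X in \<open>auto simp: word_basis_def matrix_mul_assoc\<close>)
  qed
  have h0: "(1 + c)\<^sup>2 * ?g \<ge> 0" using g0 by simp
  have le: "(1 + c)\<^sup>2 * ?g \<le> (1 + c + d) * ((1 + c)\<^sup>2 * ?g)"
    using mult_right_mono[OF _ h0, of 1 "1 + c + d"] c0 d0 by simp
  have e: "g * ?C ^ Suc t = (1 + c + d) * ((1 + c)\<^sup>2 * ?g)" by (simp add: mult_ac)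
  from WL[of t] show ?case
  proof
    assume "W (Suc t) = W t \<and> L (Suc t) = L t ** W t"
    thus ?thesis using step le unfolding nrm_bound_def e by fastforce
  next
    assume sw: "W (Suc t) = L t ** W t \<and> L (Suc t) = W t"
    have detB: "det (L t ** W t) = 1" by (simp add: det_mul det)
    have d': "\<bar>trace (W t ** (L t ** W t))\<bar> \<le> d" using d sw by blast
    \<comment> \<open>The bases of the pair taken in its two orders share all words but one, treated
      by \<open>nrm_switch\<close>; for the others the bound before the exchange suffices.\<close>
    have "nrm2 (P ** X) \<le> (1 + c + d) * ((1 + c)\<^sup>2 * ?g)" if P: "P \<in> S (Suc t)" and X: "X \<in> word_basis (L t ** W t) (W t)" for P X
    proof (cases "X = L t ** W t ** W t ** (L t ** W t)")
      case True
      have Q1: "nrm2 P \<le> (1 + c)\<^sup>2 * ?g" using step[OF P, of "mat 1"] by (simp add: word_basis_def)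
      show ?thesis unfolding True
        by (rule nrm_switch[OF detB c d' Q1]) (auto intro!: step P simp: word_basis_def)
    next
      case False
      hence "X \<in> word_basis (W t) (L t ** W t)" using X by (auto simp: word_basis_def)
      thus ?thesis using step[OF P] le by fastforce
    qed
    thus ?thesis using sw unfolding nrm_bound_def e by auto
  qed
qed

section \<open>Euclidean renormalization of the coding\<close>

text \<open>Itinerary of p under the exchange of [0, x) and [x, x + y), which is a rotation of a
  circle of length x + y; \<open>False\<close> marks the left interval.\<close>

fun coding :: "real \<Rightarrow> real \<Rightarrow> real \<Rightarrow> nat \<Rightarrow> bool list" where
  "coding x y p 0 = []"
| "coding x y p (Suc n) = (\<not> p < x) # coding x y (if p < x then p + y else p - x) n"

definition blocks :: "bool list \<Rightarrow> bool list \<Rightarrow> bool list \<Rightarrow> bool list" where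
  "blocks U V w = concat (map (\<lambda>b. if b then V else U) w)"

lemma blocks_simps [simp]: "blocks U V [] = []" "blocks U V (b # w) = (if b then V else U) @ blocks U V w"
  by (simp_all add: blocks_def)

lemma blocks_append [simp]: "blocks U V (v @ w) = blocks U V v @ blocks U V w"
  by (simp add: blocks_def)

lemma blocks_blocks: "blocks U V (blocks A B w) = blocks (blocks U V A) (blocks U V B) w"
  by (induction w) auto

lemma sublist_blocks: "sublist v w \<Longrightarrow> sublist (blocks U V v) (blocks U V w)"
  unfolding sublist_def by (metis blocks_append)

lemma blocks_letters: "blocks [False] [True] w = w"
  by (induction w) auto

text \<open>The first return map to [0, x) exchanges intervals of lengths x - y and y, with return
  words \<open>[False]\<close> and \<open>[False, True]\<close>. Return words are nonempty, so m
  \<ge> n of them cover n letters; the last one may be cut, hence a prefix.\<close>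

lemma coding_renormalize_left_aux:
  assumes "0 < y" "y < x" "0 \<le> p" "p < x" "n \<le> m"
  shows "prefix (coding x y p n) (blocks [False] [False, True] (coding (x - y) y p m))"
  using assms(3-)
proof (induction n arbitrary: p m rule: less_induct)
  case (less n)
  show ?case
  proof (cases n)
    case (Suc k)
    then obtain m' where m: "m = Suc m'" "k \<le> m'" using less.prems by (cases m) auto
    show ?thesis
    proof (cases "p < x - y")
      case True
      then show ?thesis using less.IH[of k "p + y" m'] less.prems assms(1) Suc m by auto
    next
      case False
      show ?thesis
      proof (cases k)
        case 0
        then show ?thesis using False Suc m less.prems by simp
      next
        case (Suc l)
        then show ?thesis
          using less.IH[of l "p + y - x" m'] less.prems False \<open>n = Suc k\<close> m assms(1,2)
          by (auto simp: algebra_simps)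
      qed
    qed
  qed simp
qed

lemma coding_renormalize_left:
  assumes "0 < y" "y < x" "0 \<le> p" "p < x + y"
  obtains p' m where "0 \<le> p'" "p' < x"
    "sublist (coding x y p n) (blocks [False] [False, True] (coding (x - y) y p' m))"
proof (cases "p < x")
  case True
  then show ?thesis
    using coding_renormalize_left_aux[of y x p n n] assms that by (auto intro: prefix_imp_sublist)
next
  case False
  \<comment> \<open>A start outside [0, x) is moved one step back along its orbit; this is why only
    a factor, not a prefix, is obtained.\<close>
  have "coding x y (p - y) (Suc n) = False # coding x y p n" using assms False by auto
  hence "sublist (coding x y p n) (coding x y (p - y) (Suc n))"
    by (simp add: sublist_Cons_right)
  moreover have "prefix (coding x y (p - y) (Suc n)) (blocks [False] [False, True] (coding (x - y) y (p - y) (Suc n)))"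
    using coding_renormalize_left_aux[of y x "p - y" "Suc n" "Suc n"] assms False by simp
  ultimately show ?thesis
    using that[of "p - y" "Suc n"] assms False
    by (meson diff_ge_0_iff_ge diff_less_eq not_less order.strict_implies_order order_trans prefix_imp_sublist
        sublist_order.order_trans)
qed

text \<open>The mirror image: the first return map to [x, x + y), translated by x so that the
  interval starts at 0.\<close>

lemma coding_renormalize_right_aux:
  assumes "0 < x" "x < y" "x \<le> p" "p < x + y" "n \<le> m"
  shows "prefix (coding x y p n) (blocks [True, False] [True] (coding x (y - x) (p - x) m))"
  using assms(3-)
proof (induction n arbitrary: p m rule: less_induct)
  case (less n)
  show ?case
  proof (cases n)
    case (Suc k)
    then obtain m' where m: "m = Suc m'" "k \<le> m'" using less.prems by (cases m) auto
    show ?thesis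
    proof (cases "p - x < x")
      case False
      then show ?thesis using less.IH[of k "p - x" m'] less.prems assms(1) Suc m by auto
    next
      case True
      show ?thesis
      proof (cases k)
        case 0
        then show ?thesis using True Suc m less.prems by simp
      next
        case (Suc l)
        then show ?thesis
          using less.IH[of l "p - x + y" m'] less.prems True \<open>n = Suc k\<close> m assms(1,2)
          by (auto simp: algebra_simps)
      qed
    qed
  qed simp
qed

lemma coding_renormalize_right:
  assumes "0 < x" "x < y" "0 \<le> p" "p < x + y"
  obtains p' m where "0 \<le> p'" "p' < y"
    "sublist (coding x y p n) (blocks [True, False] [True] (coding x (y - x) p' m))"
proof (cases "p < x")
  case False
  then show ?thesis
    using coding_renormalize_right_aux[of x y p n n] assms that[of "p - x" n] by (auto intro: prefix_imp_sublist)
next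
  case True
  have "coding x y (p + x) (Suc n) = True # coding x y p n" using assms True by auto
  hence "sublist (coding x y p n) (coding x y (p + x) (Suc n))"
    by (simp add: sublist_Cons_right)
  moreover have "prefix (coding x y (p + x) (Suc n)) (blocks [True, False] [True] (coding x (y - x) p (Suc n)))"
    using coding_renormalize_right_aux[of x y "p + x" "Suc n" "Suc n"] assms True by simp
  ultimately show ?thesis
    using that[of p "Suc n"] assms True
    by (meson less_trans prefix_imp_sublist sublist_order.order_trans)
qed

section \<open>The slow Euclidean algorithm on lengths and blocks\<close>

type_synonym euclid_state = "real \<times> real \<times> bool list \<times> bool list"

text \<open>A state holds the lengths of the two exchanged intervals and the return words of their
  points, spelled in the original letters.\<close>

fun euclid_step :: "euclid_state \<Rightarrow> euclid_state" where
  "euclid_step (x, y, U, V) = (if y < x then (x - y, y, U, U @ V) else (x, y - x, V @ U, V))"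

definition euclid :: "real \<Rightarrow> nat \<Rightarrow> euclid_state" where
  "euclid \<alpha> t = (euclid_step ^^ t) (1 - \<alpha>, \<alpha>, [False], [True])"

lemma euclid_0: "euclid \<alpha> 0 = (1 - \<alpha>, \<alpha>, [False], [True])"
  by (simp add: euclid_def)

lemma euclid_Suc: "euclid \<alpha> (Suc t) = euclid_step (euclid \<alpha> t)"
  by (simp add: euclid_def)

text \<open>The ratio stays irrational, which excludes a tie and keeps both lengths
  positive.\<close>

lemma euclid_positive:
  assumes "0 < \<alpha>" "\<alpha> < 1" "\<alpha> \<notin> \<rat>" "euclid \<alpha> t = (x, y, U, V)"
  shows "0 < x \<and> 0 < y \<and> x / y \<notin> \<rat>"
  using assms(4)
proof (induction t arbitrary: x y U V)
  case 0
  have "(1 - \<alpha>) / \<alpha> = 1 / \<alpha> - 1" using assms(1) by (simp add: field_simps)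
  moreover have "1 / \<alpha> - 1 \<notin> \<rat>"
  proof
    assume "1 / \<alpha> - 1 \<in> \<rat>"
    hence "1 / (1 / \<alpha> - 1 + 1) \<in> \<rat>" by (intro Rats_divide Rats_add Rats_1)
    thus False using assms(3) by simp
  qed
  ultimately show ?case using 0 assms(1,2) by (auto simp: euclid_0)
next
  case (Suc t)
  obtain x' y' U' V' where s: "euclid \<alpha> t = (x', y', U', V')" by (metis prod_cases4)
  note IH = Suc.IH[OF s]
  hence ne: "x' \<noteq> y'" by auto
  show ?case
  proof (cases "y' < x'")
    case True
    hence xy: "x = x' - y'" "y = y'" using Suc.prems s by (auto simp: euclid_Suc)
    have "x / y = x' / y' - 1" using IH xy by (simp add: field_simps)
    moreover have "x' / y' - 1 \<notin> \<rat>"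
      using IH Rats_add[of "x' / y' - 1" 1] by auto
    ultimately show ?thesis using IH True xy by simp
  next
    case False
    hence xy: "x = x'" "y = y' - x'" using Suc.prems s by (auto simp: euclid_Suc)
    have "x' / y' = 1 / (1 + 1 / (x / y))" using IH xy False ne by (simp add: field_simps)
    hence "x / y \<notin> \<rat>" using IH Rats_divide Rats_add Rats_1 by metis
    thus ?thesis using IH False ne xy by simp
  qed
qed

lemma coding_in_blocks:
  assumes "0 < \<alpha>" "\<alpha> < 1" "\<alpha> \<notin> \<rat>" "0 \<le> p" "p < 1" "euclid \<alpha> t = (x, y, U, V)"
  shows "\<exists>p' m. 0 \<le> p' \<and> p' < x + y \<and> sublist (coding (1 - \<alpha>) \<alpha> p n) (blocks U V (coding x y p' m))"
  using assms(6)
proof (induction t arbitrary: x y U V)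
  case 0
  thus ?case using assms(4,5) by (auto simp: euclid_0 blocks_letters intro!: exI[of _ p])
next
  case (Suc t)
  obtain x' y' U' V' where s: "euclid \<alpha> t = (x', y', U', V')" by (metis prod_cases4)
  note pos = euclid_positive[OF assms(1-3) s]
  hence ne: "x' \<noteq> y'" by auto
  obtain p' m where p': "0 \<le> p'" "p' < x' + y'" "sublist (coding (1 - \<alpha>) \<alpha> p n) (blocks U' V' (coding x' y' p' m))"
    using Suc.IH[OF s] by blast
  show ?case
  proof (cases "y' < x'")
    case True
    hence e: "x = x' - y'" "y = y'" "U = U'" "V = U' @ V'" using Suc.prems s by (auto simp: euclid_Suc)
    obtain p'' m' where p'': "0 \<le> p''" "p'' < x'"
        "sublist (coding x' y' p' m) (blocks [False] [False, True] (coding (x' - y') y' p'' m'))"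
      using coding_renormalize_left[of y' x' p'] pos True p'(1,2) by metis
    have "sublist (blocks U' V' (coding x' y' p' m)) (blocks U V (coding x y p'' m'))"
      using sublist_blocks[OF p''(3), of U' V'] by (simp add: blocks_blocks e)
    thus ?thesis using p' p'' e by (metis diff_add_cancel sublist_order.order_trans)
  next
    case False
    hence e: "x = x'" "y = y' - x'" "U = V' @ U'" "V = V'" using Suc.prems s by (auto simp: euclid_Suc)
    obtain p'' m' where p'': "0 \<le> p''" "p'' < y'"
        "sublist (coding x' y' p' m) (blocks [True, False] [True] (coding x' (y' - x') p'' m'))"
      using coding_renormalize_right[of x' y' p'] pos False ne p'(1,2) by (metis linorder_neqE)
    have "sublist (blocks U' V' (coding x' y' p' m)) (blocks U V (coding x y p'' m'))"
      using sublist_blocks[OF p''(3), of U' V'] by (simp add: blocks_blocks e)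
    thus ?thesis using p' p'' e by (metis add.commute diff_add_cancel sublist_order.order_trans)
  qed
qed

text \<open>A word no longer than either block that leaves the block where it starts ends within the
  next one, so it is a suffix of one followed by a prefix of the other.\<close>

lemma sublist_two_blocks:
  assumes "sublist w (blocks U V b)" "length w \<le> length U" "length w \<le> length V"
  shows "\<exists>X\<in>{U, V}. \<exists>Y\<in>{U, V}. sublist w (X @ Y)"
  using assms(1)
proof (induction b)
  case (Cons c b)
  let ?X = "if c then V else U"
  have "sublist w (?X @ blocks U V b)" using Cons.prems by simp
  then consider "sublist w ?X" | "sublist w (blocks U V b)"
    | w1 w2 where "w = w1 @ w2" "suffix w1 ?X" "prefix w2 (blocks U V b)"
    by (auto simp: sublist_append)
  then show ?case
  proof cases
    case 1
    then have "sublist w (?X @ U)" by (simp add: sublist_append)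
    then show ?thesis by (cases c) auto
  next
    case 2
    then show ?thesis by (rule Cons.IH)
  next
    case 3
    obtain Y where Y: "Y \<in> {U, V}" "prefix w2 Y"
    proof (cases b)
      case Nil
      then show ?thesis using 3 that[of U] by simp
    next
      case (Cons d b')
      let ?Y = "if d then V else U"
      have "length w2 \<le> length ?Y" using 3(1) assms(2,3) by auto
      hence "prefix w2 ?Y" using 3(3) Cons prefix_length_prefix[of w2 "?Y @ blocks U V b'" ?Y] by simp
      then show ?thesis using that[of ?Y] by (cases d) auto
    qed
    have "sublist w (?X @ Y)" using 3 Y by (auto simp: sublist_append)
    then show ?thesis using Y by (cases c) auto
  qed
qed auto

section \<open>Continued fraction digits and the growth of block lengths\<close>

lemma gauss_iter_irrational:
  assumes "0 < \<alpha>" "\<alpha> < 1" "\<alpha> \<notin> \<rat>"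
  shows "0 < gauss_iter \<alpha> n \<and> gauss_iter \<alpha> n < 1 \<and> gauss_iter \<alpha> n \<notin> \<rat>"
proof (induction n)
  case (Suc n)
  let ?g = "gauss_iter \<alpha> n"
  have "frac (1 / ?g) \<notin> \<rat>"
  proof
    assume "frac (1 / ?g) \<in> \<rat>"
    hence "1 / (frac (1 / ?g) + of_int \<lfloor>1 / ?g\<rfloor>) \<in> \<rat>" by (intro Rats_divide Rats_add Rats_1 Rats_of_int)
    thus False using Suc by (simp add: frac_def)
  qed
  moreover from this have "frac (1 / ?g) \<noteq> 0" by (metis Rats_0)
  ultimately show ?case
    using frac_ge_0[of "1 / ?g"] frac_lt_1[of "1 / ?g"] by (auto simp: less_le simp del: frac_eq_0_iff)
qed (use assms in auto)

lemma cf_digit_props: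
  assumes "0 < \<alpha>" "\<alpha> < 1" "\<alpha> \<notin> \<rat>"
  shows "cf_digit \<alpha> (Suc n) \<ge> 1"
    "real (cf_digit \<alpha> (Suc n)) = 1 / gauss_iter \<alpha> n - gauss_iter \<alpha> (Suc n)"
    "real (cf_digit \<alpha> (Suc n)) * gauss_iter \<alpha> n = 1 - gauss_iter \<alpha> n * gauss_iter \<alpha> (Suc n)"
proof -
  let ?g = "gauss_iter \<alpha> n"
  have g: "0 < ?g" "?g < 1" using gauss_iter_irrational[OF assms] by auto
  hence "1 < 1 / ?g" by simp
  hence f: "\<lfloor>1 / ?g\<rfloor> \<ge> 1" by linarith
  thus "cf_digit \<alpha> (Suc n) \<ge> 1" by (simp add: cf_digit_def nat_le_iff le_nat_iff del: one_le_floor)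
  show e: "real (cf_digit \<alpha> (Suc n)) = 1 / ?g - gauss_iter \<alpha> (Suc n)"
    using g by (simp add: cf_digit_def frac_def)
  show "real (cf_digit \<alpha> (Suc n)) * ?g = 1 - ?g * gauss_iter \<alpha> (Suc n)"
    unfolding e using g by (simp add: algebra_simps)
qed

lemma euclid_run_left:
  "y > 0 \<Longrightarrow> real j * y < x \<Longrightarrow> \<exists>W. (euclid_step ^^ j) (x, y, U, V) = (x - real j * y, y, U, W)
      \<and> length W = length V + j * length U"
proof (induction j)
  case (Suc j)
  hence "real j * y < x" by (simp add: algebra_simps)
  then obtain W where "(euclid_step ^^ j) (x, y, U, V) = (x - real j * y, y, U, W)" "length W = length V + j * length U"
    using Suc by blast
  moreover have "y < x - real j * y" using Suc.prems by (simp add: algebra_simps)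
  ultimately show ?case by (simp add: algebra_simps)
qed simp

lemma euclid_run_right:
  "x > 0 \<Longrightarrow> real j * x < y \<Longrightarrow> \<exists>W. (euclid_step ^^ j) (x, y, U, V) = (x, y - real j * x, W, V)
      \<and> length W = length U + j * length V"
proof (induction j)
  case (Suc j)
  hence "real j * x < y" by (simp add: algebra_simps)
  then obtain W where "(euclid_step ^^ j) (x, y, U, V) = (x, y - real j * x, W, V)" "length W = length U + j * length V"
    using Suc by blast
  moreover have "\<not> y - real j * x < x" using Suc.prems by (simp add: algebra_simps)
  ultimately show ?case by (simp add: algebra_simps)
qed simp

text \<open>A maximal run of equal Euclidean steps performs one step of the Gauss map; it ends in a state
  where the two lengths have ratio \<open>g\<close>. Here \<open>P\<close> belongs to the longer interval.\<close>

definition run_end :: "real \<Rightarrow> nat \<Rightarrow> nat \<Rightarrow> euclid_state \<Rightarrow> bool" where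
  "run_end g P Q s \<longleftrightarrow> (\<exists>x y U V. s = (x, y, U, V) \<and> 0 < x \<and> 0 < y \<and>
     (x = g * y \<and> P \<le> length V \<and> Q \<le> length U \<or> y = g * x \<and> P \<le> length U \<and> Q \<le> length V))"

text \<open>The block of the shorter interval absorbs a \<ge> 1 copies of the other one and then
  belongs to the longer interval, so the length bounds change as in the Fibonacci recursion.\<close>

lemma run_end_step:
  assumes \<alpha>: "0 < \<alpha>" "\<alpha> < 1" "\<alpha> \<notin> \<rat>" and run: "run_end (gauss_iter \<alpha> n) P Q s"
  shows "run_end (gauss_iter \<alpha> (Suc n)) (P + Q) P ((euclid_step ^^ cf_digit \<alpha> (Suc n)) s)"
proof -
  let ?g = "gauss_iter \<alpha> n" and ?g' = "gauss_iter \<alpha> (Suc n)" and ?a = "cf_digit \<alpha> (Suc n)"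
  have g: "0 < ?g" and g': "0 < ?g'" using gauss_iter_irrational[OF \<alpha>] by blast+
  note a = cf_digit_props[OF \<alpha>, of n]
  have ag: "real ?a * (?g * z) = z - (?g * z) * ?g'" for z
    using a(3) by (metis (no_types, opaque_lifting) left_diff_distrib mult.assoc mult.commute mult_1)
  have le: "P \<le> ?a * l" if "P \<le> l" for l using a(1) that by (metis le_trans mult_le_mono1 mult_1)
  from run obtain x y U V where s: "s = (x, y, U, V)" "0 < x" "0 < y"
    and c: "x = ?g * y \<and> P \<le> length V \<and> Q \<le> length U \<or> y = ?g * x \<and> P \<le> length U \<and> Q \<le> length V"
    by (auto simp: run_end_def)
  from c show ?thesis
  proof
    assume c: "x = ?g * y \<and> P \<le> length V \<and> Q \<le> length U"
    have d: "y - real ?a * x = ?g' * x" using c ag[of y] by (simp add: mult.commute)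
    moreover have "?g' * x > 0" using g' s by simp
    ultimately obtain W where "(euclid_step ^^ ?a) (x, y, U, V) = (x, ?g' * x, W, V)"
        "length W = length U + ?a * length V"
      using euclid_run_right[of x ?a y U V] s by auto
    thus ?thesis
      using s c \<open>?g' * x > 0\<close> le[of "length V"] unfolding run_end_def by (intro exI[of _ x] exI[of _ "?g' * x"]) auto
  next
    assume c: "y = ?g * x \<and> P \<le> length U \<and> Q \<le> length V"
    have d: "x - real ?a * y = ?g' * y" using c ag[of x] by (simp add: mult.commute)
    moreover have "?g' * y > 0" using g' s by simp
    ultimately obtain W where "(euclid_step ^^ ?a) (x, y, U, V) = (?g' * y, y, U, W)"
        "length W = length V + ?a * length U"
      using euclid_run_left[of y ?a x U V] s by auto
    thus ?thesis
      using s c \<open>?g' * y > 0\<close> le[of "length U"] unfolding run_end_def by (intro exI[of _ "?g' * y"] exI[of _ y]) auto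
  qed
qed

lemma run_end_mono: "run_end g P Q s \<Longrightarrow> P' \<le> P \<Longrightarrow> Q' \<le> Q \<Longrightarrow> run_end g P' Q' s"
  unfolding run_end_def by fastforce

lemma run_end_euclid:
  assumes \<alpha>: "0 < \<alpha>" "\<alpha> < 1" "\<alpha> \<notin> \<rat>"
  shows "run_end (gauss_iter \<alpha> (2 * m + 1)) (2 ^ m) (2 ^ m) (euclid \<alpha> ((\<Sum>j=1..2*m+1. cf_digit \<alpha> j) - 1))"
proof (induction m)
  case 0
  let ?a = "cf_digit \<alpha> 1" and ?g = "gauss_iter \<alpha> 1"
  note a = cf_digit_props[OF \<alpha>, of 0, simplified, folded One_nat_def]
  have g: "0 < ?g" using gauss_iter_irrational[OF \<alpha>] by blast
  have a1: "real (?a - 1) = real ?a - 1" using a(1) by simp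
  have g1: "gauss_iter \<alpha> 1 = frac (1 / \<alpha>)" by simp
  have aa: "real ?a * \<alpha> = 1 - \<alpha> * ?g" using a(3) unfolding g1 .
  \<comment> \<open>The starting lengths 1 - \<alpha> and \<alpha> arise from 1 and \<alpha> by one
    subtraction, so the first run has one step less than the first digit.\<close>
  have "real (?a - 1) * \<alpha> = 1 - \<alpha> - ?g * \<alpha>"
    unfolding a1 left_diff_distrib aa by simp
  moreover from this have "real (?a - 1) * \<alpha> < 1 - \<alpha>" using g \<alpha>(1) by simp
  ultimately obtain W where "euclid \<alpha> (?a - 1) = (?g * \<alpha>, \<alpha>, [False], W)" "length W \<ge> 1"
    using euclid_run_left[of \<alpha> "?a - 1" "1 - \<alpha>" "[False]" "[True]"] \<alpha>(1) by (auto simp: euclid_def simp del: gauss_iter.simps)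
  thus ?case using g \<alpha>(1) by (auto simp: run_end_def simp del: gauss_iter.simps)
next
  case (Suc m)
  let ?S = "\<lambda>k. \<Sum>j=1..k. cf_digit \<alpha> j"
  let ?n = "2 * m + 1"
  have S1: "?S ?n \<ge> 1"
    using cf_digit_props(1)[OF \<alpha>, of 0] member_le_sum[of 1 "{1..?n}" "cf_digit \<alpha>"] by simp
  have "?S (Suc (Suc ?n)) - 1 = cf_digit \<alpha> (Suc (Suc ?n)) + (cf_digit \<alpha> (Suc ?n) + (?S ?n - 1))"
    using S1 by simp
  hence e: "euclid \<alpha> (?S (Suc (Suc ?n)) - 1) = (euclid_step ^^ cf_digit \<alpha> (Suc (Suc ?n)))
       ((euclid_step ^^ cf_digit \<alpha> (Suc ?n)) (euclid \<alpha> (?S ?n - 1)))"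
    by (simp add: euclid_def funpow_add)
  \<comment> \<open>Two runs turn (P, Q) into (2P + Q, P + Q), and for P = Q = 2^m both entries
    reach 2^(m+1).\<close>
  have "run_end (gauss_iter \<alpha> (Suc (Suc ?n))) (2 ^ Suc m) (2 ^ Suc m) (euclid \<alpha> (?S (Suc (Suc ?n)) - 1))"
    unfolding e using run_end_step[OF \<alpha> run_end_step[OF \<alpha> Suc.IH]] by (rule run_end_mono) auto
  thus ?case by simp
qed

lemma bounded_density_bound:
  assumes "bounded_density \<alpha>"
  obtains K :: nat where "\<And>n. (\<Sum>j=1..n. cf_digit \<alpha> j) \<le> K * n"
proof -
  let ?S = "\<lambda>n. \<Sum>j=1..n. cf_digit \<alpha> j"
  let ?f = "\<lambda>n. ereal ((1 / real n) * (\<Sum>j=1..n. real (cf_digit \<alpha> j)))"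
  have "limsup ?f < \<infinity>" using assms by (simp add: bounded_density_def)
  then obtain c where c: "limsup ?f < ereal c" by (meson ereal_dense2)
  hence "eventually (\<lambda>n. ?f n < ereal c) sequentially" by (rule Limsup_lessD)
  then obtain N where N: "\<And>n. n \<ge> N \<Longrightarrow> (1 / real n) * (\<Sum>j=1..n. real (cf_digit \<alpha> j)) < c"
    by (auto simp: eventually_sequentially)
  \<comment> \<open>The ceiling of c serves for large n, and the sum absorbs the finitely many digit
    sums before N.\<close>
  define K where "K = nat \<lceil>c\<rceil> + (\<Sum>n\<le>N. ?S n)"
  have "?S n \<le> K * n" for n
  proof (cases "n = 0 \<or> n \<ge> N")
    case True
    show ?thesis
    proof (cases "n = 0")
      case False
      hence "real (?S n) < c * real n" using N[of n] True by (simp add: field_simps)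
      also have "c * real n \<le> real (nat \<lceil>c\<rceil>) * real n" by (intro mult_right_mono real_nat_ceiling_ge) simp
      finally have "real (?S n) \<le> real (nat \<lceil>c\<rceil> * n)" by simp
      hence "?S n \<le> nat \<lceil>c\<rceil> * n" by (simp only: of_nat_le_iff)
      also have "\<dots> \<le> K * n" by (simp add: K_def)
      finally show ?thesis .
    qed simp
  next
    case False
    have "?S n \<le> (\<Sum>n\<le>N. ?S n)" using False by (intro member_le_sum) auto
    also have "\<dots> \<le> K" by (simp add: K_def)
    also have "\<dots> \<le> K * n" using False by simp
    finally show ?thesis .
  qed
  thus ?thesis using that by blast
qed

lemma block_growth:
  assumes \<alpha>: "0 < \<alpha>" "\<alpha> < 1" "\<alpha> \<notin> \<rat>" "bounded_density \<alpha>"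
  obtains K :: nat where "\<And>m. \<exists>t \<le> K * (2 * m + 1). \<exists>x y U V. euclid \<alpha> t = (x, y, U, V) \<and> 2 ^ m \<le> length U \<and> 2 ^ m \<le> length V"
proof -
  obtain K where K: "\<And>n. (\<Sum>j=1..n. cf_digit \<alpha> j) \<le> K * n" using bounded_density_bound[OF \<alpha>(4)] by blast
  show ?thesis
  proof
    fix m
    have "(\<Sum>j=1..2*m+1. cf_digit \<alpha> j) - 1 \<le> K * (2 * m + 1)"
      using K[of "2*m+1"] by linarith
    thus "\<exists>t \<le> K * (2 * m + 1). \<exists>x y U V. euclid \<alpha> t = (x, y, U, V) \<and> 2 ^ m \<le> length U \<and> 2 ^ m \<le> length V"
      using run_end_euclid[OF \<alpha>(1-3), of m] unfolding run_end_def by blast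
  qed
qed

section \<open>Approximate eigenvectors\<close>

definition jacobi :: "(int \<Rightarrow> real) \<Rightarrow> (int \<Rightarrow> complex) \<Rightarrow> int \<Rightarrow> complex" where
  "jacobi d u n = u (n + 1) + u (n - 1) + complex_of_real (d n) * u n"

definition shifted :: "(int \<Rightarrow> real) \<Rightarrow> complex \<Rightarrow> (int \<Rightarrow> complex) \<Rightarrow> int \<Rightarrow> complex" where
  "shifted d E u n = jacobi d u n - E * u n"

definition sqn :: "(int \<Rightarrow> complex) \<Rightarrow> real" where
  "sqn u = (\<Sum>\<^sub>\<infinity>n. (cmod (u n))\<^sup>2)"

definition re_inner :: "(int \<Rightarrow> complex) \<Rightarrow> (int \<Rightarrow> complex) \<Rightarrow> real" where
  "re_inner u v = (\<Sum>\<^sub>\<infinity>n. Re (u n * cnj (v n)))"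

lemma ell2_sqn: "ell2_norm u = sqrt (sqn u)"
  by (simp add: ell2_norm_def sqn_def)

lemma sqn_nonneg: "sqn u \<ge> 0"
  unfolding sqn_def by (intro infsum_nonneg) simp

lemma ell2_summable: "u \<in> ell2 \<Longrightarrow> (\<lambda>n. (cmod (u n))\<^sup>2) summable_on UNIV"
  by (simp add: ell2_def)

lemma ell2_dominated:
  assumes "f summable_on UNIV" "\<And>n. (cmod (u n))\<^sup>2 \<le> f n"
  shows "u \<in> ell2" "sqn u \<le> infsum f UNIV"
proof -
  show "u \<in> ell2" unfolding ell2_def mem_Collect_eq
    by (rule summable_on_comparison_test[OF assms(1)]) (use assms(2) in auto)
  thus "sqn u \<le> infsum f UNIV" unfolding sqn_def
    by (intro infsum_mono assms ell2_summable)
qed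

lemma cmod_add_square: "(cmod (a + b))\<^sup>2 \<le> 2 * (cmod a)\<^sup>2 + 2 * (cmod b)\<^sup>2"
proof -
  have "(cmod (a + b))\<^sup>2 \<le> (cmod a + cmod b)\<^sup>2"
    by (intro power_mono norm_triangle_ineq) simp
  also have "\<dots> \<le> 2 * (cmod a)\<^sup>2 + 2 * (cmod b)\<^sup>2"
    using sum_squares_ge_zero[of "cmod a - cmod b" 0] by (simp add: power2_eq_square algebra_simps)
  finally show ?thesis .
qed

lemma ell2_add:
  assumes "u \<in> ell2" "v \<in> ell2"
  shows "(\<lambda>n. u n + v n) \<in> ell2" "sqn (\<lambda>n. u n + v n) \<le> 2 * sqn u + 2 * sqn v"
proof -
  note s = ell2_summable[OF assms(1)] ell2_summable[OF assms(2)]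
  have "(\<lambda>n. 2 * (cmod (u n))\<^sup>2 + 2 * (cmod (v n))\<^sup>2) summable_on UNIV"
    by (intro summable_on_add summable_on_cmult_right s)
  note * = ell2_dominated[OF this, of "\<lambda>n. u n + v n", OF cmod_add_square]
  show "(\<lambda>n. u n + v n) \<in> ell2" by (rule *)
  show "sqn (\<lambda>n. u n + v n) \<le> 2 * sqn u + 2 * sqn v"
    using *(2) unfolding sqn_def
    by (simp add: infsum_add infsum_cmult_right' summable_on_cmult_right s)
qed

lemma ell2_bounded_mult:
  assumes "u \<in> ell2" "\<forall>n. cmod (a n) \<le> C"
  shows "(\<lambda>n. a n * u n) \<in> ell2" "sqn (\<lambda>n. a n * u n) \<le> C\<^sup>2 * sqn u"
proof -
  have "(\<lambda>n. C\<^sup>2 * (cmod (u n))\<^sup>2) summable_on UNIV"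
    by (intro summable_on_cmult_right ell2_summable assms)
  moreover have "(cmod (a n * u n))\<^sup>2 \<le> C\<^sup>2 * (cmod (u n))\<^sup>2" for n
    unfolding norm_mult power_mult_distrib by (intro mult_right_mono power_mono spec[OF assms(2)]) auto
  ultimately have *: "(\<lambda>n. a n * u n) \<in> ell2" "sqn (\<lambda>n. a n * u n) \<le> (\<Sum>\<^sub>\<infinity>n. C\<^sup>2 * (cmod (u n))\<^sup>2)"
    using ell2_dominated[of "\<lambda>n. C\<^sup>2 * (cmod (u n))\<^sup>2" "\<lambda>n. a n * u n"] by auto
  show "(\<lambda>n. a n * u n) \<in> ell2" "sqn (\<lambda>n. a n * u n) \<le> C\<^sup>2 * sqn u"
    using * by (auto simp: sqn_def infsum_cmult_right')
qed

lemma ell2_scale: "u \<in> ell2 \<Longrightarrow> (\<lambda>n. a * u n) \<in> ell2"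
  using ell2_bounded_mult(1)[of u "\<lambda>_. a" "cmod a"] by simp

lemma ell2_diff: "u \<in> ell2 \<Longrightarrow> v \<in> ell2 \<Longrightarrow> (\<lambda>n. u n - v n) \<in> ell2"
  using ell2_add(1)[of u "\<lambda>n. -1 * v n"] ell2_scale[of v "-1"] by simp

lemma bij_int_shift: "bij_betw (\<lambda>n::int. n + k) UNIV UNIV"
  by (rule bij_betwI[where g = "\<lambda>n. n - k"]) auto

lemma infsum_int_shift: "(\<Sum>\<^sub>\<infinity>n. f (n + k)) = (\<Sum>\<^sub>\<infinity>n::int. f n)"
  using infsum_reindex_bij_betw[OF bij_int_shift] by blast

lemma summable_on_int_shift: "(\<lambda>n::int. f (n + k)) summable_on UNIV \<longleftrightarrow> f summable_on UNIV"
  using summable_on_reindex_bij_betw[OF bij_int_shift] by blast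

lemma ell2_shift:
  shows "u \<in> ell2 \<Longrightarrow> (\<lambda>n. u (n + k)) \<in> ell2" "sqn (\<lambda>n. u (n + k)) = sqn u"
  using summable_on_int_shift[of "\<lambda>n. (cmod (u n))\<^sup>2" k] infsum_int_shift[of "\<lambda>n. (cmod (u n))\<^sup>2" k]
  by (auto simp: ell2_def sqn_def)

lemma ell2_shifted:
  assumes d: "\<forall>n. \<bar>d n\<bar> \<le> D" and u: "u \<in> ell2"
  shows "shifted d E u \<in> ell2" "sqn (shifted d E u) \<le> (8 + 2 * (D + cmod E)\<^sup>2) * sqn u"
proof -
  let ?a = "\<lambda>n. complex_of_real (d n) - E"
  have a: "\<forall>n. cmod (?a n) \<le> D + cmod E"
  proof
    show "cmod (?a n) \<le> D + cmod E" for n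
      using norm_triangle_ineq4[of "complex_of_real (d n)" E] spec[OF d, of n] by simp
  qed
  have e: "shifted d E u = (\<lambda>n. (u (n + 1) + u (n + (-1))) + ?a n * u n)"
    by (auto simp: shifted_def jacobi_def algebra_simps)
  note s = ell2_shift(1)[OF u, of 1] ell2_shift(1)[OF u, of "-1"]
  note su = ell2_add[OF s]
  note bm = ell2_bounded_mult[OF u a]
  show "shifted d E u \<in> ell2" unfolding e by (rule ell2_add(1)[OF su(1) bm(1)])
  \<comment> \<open>Two uses of |a + b|^2 \<le> 2|a|^2 + 2|b|^2: the shifts contribute 2(2 + 2) = 8,
    the multiplication 2(D + |E|)^2.\<close>
  have "sqn (shifted d E u) \<le> 8 * sqn u + 2 * ((D + cmod E)\<^sup>2 * sqn u)"
  proof -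
    have *: "p \<le> 2 * q + 2 * r \<Longrightarrow> q \<le> 2 * s + 2 * t \<Longrightarrow> r \<le> z \<Longrightarrow> s = w \<Longrightarrow> t = w \<Longrightarrow>
        p \<le> 8 * w + 2 * z" for p q r s t w z :: real
      by linarith
    show ?thesis
      unfolding e by (rule *[OF ell2_add(2)[OF su(1) bm(1)] su(2) bm(2) ell2_shift(2) ell2_shift(2)])
  qed
  thus "sqn (shifted d E u) \<le> (8 + 2 * (D + cmod E)\<^sup>2) * sqn u" by (simp add: algebra_simps)
qed

lemma ip_summable:
  assumes "u \<in> ell2" "v \<in> ell2"
  shows "(\<lambda>n. Re (u n * cnj (v n))) summable_on UNIV"
proof -
  have "(\<lambda>n. (cmod (u n))\<^sup>2 + (cmod (v n))\<^sup>2) summable_on UNIV"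
    by (intro summable_on_add ell2_summable assms)
  moreover have "norm (Re (u n * cnj (v n))) \<le> (cmod (u n))\<^sup>2 + (cmod (v n))\<^sup>2" for n
  proof -
    have "norm (Re (u n * cnj (v n))) \<le> cmod (u n) * cmod (v n)"
      using abs_Re_le_cmod[of "u n * cnj (v n)"] by (simp add: norm_mult)
    also have "\<dots> \<le> (cmod (u n))\<^sup>2 + (cmod (v n))\<^sup>2"
      using sum_squares_bound[of "cmod (u n)" "cmod (v n)", unfolded mult.assoc]
        mult_nonneg_nonneg[OF norm_ge_zero norm_ge_zero, of "u n" "v n"] by linarith
    finally show ?thesis .
  qed
  ultimately have "(\<lambda>n. norm (Re (u n * cnj (v n)))) summable_on UNIV"
    by (rule summable_on_comparison_test) auto
  thus ?thesis by (rule abs_summable_summable)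
qed

lemma ip_commute: "re_inner u v = re_inner v u"
  unfolding re_inner_def by (intro infsum_cong) (simp add: algebra_simps)

lemma ip_add_right:
  assumes "u \<in> ell2" "v \<in> ell2" "w \<in> ell2"
  shows "re_inner u (\<lambda>n. v n + w n) = re_inner u v + re_inner u w"
proof -
  have "re_inner u (\<lambda>n. v n + w n) = (\<Sum>\<^sub>\<infinity>n. Re (u n * cnj (v n)) + Re (u n * cnj (w n)))"
    unfolding re_inner_def by (intro infsum_cong) (simp add: algebra_simps)
  also have "\<dots> = re_inner u v + re_inner u w"
    unfolding re_inner_def by (intro infsum_add ip_summable assms)
  finally show ?thesis .
qed

lemma ip_add_left:
  assumes "u \<in> ell2" "v \<in> ell2" "w \<in> ell2"
  shows "re_inner (\<lambda>n. v n + w n) u = re_inner v u + re_inner w u"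
  using ip_add_right[OF assms] by (simp only: ip_commute[of u])

lemma sqn_ip: "sqn u = re_inner u u"
proof -
  have "(cmod z)\<^sup>2 = Re (z * cnj z)" for z
    by (simp only: cmod_power2) (simp add: power2_eq_square)
  thus ?thesis by (simp only: re_inner_def sqn_def)
qed

lemma ip_scale_left: "re_inner (\<lambda>n. of_real c * u n) v = c * re_inner u v"
proof -
  have "Re (of_real c * u n * cnj (v n)) = c * Re (u n * cnj (v n))" for n
    by (simp add: algebra_simps)
  thus ?thesis by (simp only: re_inner_def infsum_cmult_right')
qed

lemma sqn_diff:
  assumes "u \<in> ell2" "w \<in> ell2"
  shows "sqn (\<lambda>n. u n - of_real c * w n) = sqn u - 2 * c * re_inner u w + c\<^sup>2 * sqn w"
proof -
  define v where "v = (\<lambda>n. of_real (- c) * w n)"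
  have v: "v \<in> ell2" unfolding v_def by (rule ell2_scale[OF assms(2)])
  have vl: "re_inner v x = - c * re_inner w x" for x unfolding v_def by (rule ip_scale_left)
  have e: "(\<lambda>n. u n - of_real c * w n) = (\<lambda>n. u n + v n)" by (simp add: v_def)
  have "sqn (\<lambda>n. u n - of_real c * w n) = re_inner u u + re_inner u v + (re_inner v u + re_inner v v)"
    unfolding e sqn_ip
    by (simp only: ip_add_left[OF ell2_add(1)[OF assms(1) v] assms(1) v] ip_add_right[OF assms(1) assms(1) v]
        ip_add_right[OF v assms(1) v])
  moreover have "re_inner u v = - c * re_inner u w" "re_inner v u = - c * re_inner u w" "re_inner v v = c\<^sup>2 * re_inner w w"
    using vl[of u] vl[of v] vl[of w] ip_commute[of u v] ip_commute[of u w] ip_commute[of w v]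
    by (simp_all add: power2_eq_square)
  ultimately show ?thesis by (simp add: sqn_ip)
qed

lemma shifted_adjoint:
  assumes d: "\<forall>n. \<bar>d n\<bar> \<le> D" and u: "u \<in> ell2" and v: "v \<in> ell2"
  shows "re_inner (shifted d E u) v = re_inner u (shifted d (cnj E) v)"
proof -
  let ?a = "\<lambda>n. complex_of_real (d n) - E"
  have a: "\<forall>n. cmod (?a n) \<le> D + cmod E"
  proof
    show "cmod (?a n) \<le> D + cmod E" for n
      using norm_triangle_ineq4[of "complex_of_real (d n)" E] spec[OF d, of n] by simp
  qed
  have a': "\<forall>n. cmod (cnj (?a n)) \<le> D + cmod E"
    using a by (simp only: complex_mod_cnj simp_thms)
  have e: "shifted d E u = (\<lambda>n. (u (n + 1) + u (n + (-1))) + ?a n * u n)"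
    by (auto simp: shifted_def jacobi_def algebra_simps)
  have e': "shifted d (cnj E) v = (\<lambda>n. (v (n + (-1)) + v (n + 1)) + cnj (?a n) * v n)"
    by (auto simp: shifted_def jacobi_def algebra_simps)
  have sh: "re_inner (\<lambda>n. u (n + k)) v = re_inner u (\<lambda>n. v (n + (-k)))" for k
    unfolding re_inner_def using infsum_int_shift[of "\<lambda>n. Re (u n * cnj (v (n + (-k))))" k] by simp
  have mu: "re_inner (\<lambda>n. ?a n * u n) v = re_inner u (\<lambda>n. cnj (?a n) * v n)"
    unfolding re_inner_def by (intro infsum_cong) (simp add: algebra_simps)
  note su = ell2_shift(1)[OF u, of 1] ell2_shift(1)[OF u, of "-1"]
  note sv = ell2_shift(1)[OF v, of "-1"] ell2_shift(1)[OF v, of 1]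
  show ?thesis
    unfolding e e'
    unfolding ip_add_left[OF v ell2_add(1)[OF su] ell2_bounded_mult(1)[OF u a]]
      ip_add_right[OF u ell2_add(1)[OF sv] ell2_bounded_mult(1)[OF v a']]
      ip_add_left[OF v su] ip_add_right[OF u sv] mu sh by simp
qed

lemma cmod_le_ell2_norm:
  assumes "u \<in> ell2" shows "cmod (u n) \<le> ell2_norm u"
proof -
  have "(\<Sum>k\<in>{n}. (cmod (u k))\<^sup>2) \<le> sqn u"
    unfolding sqn_def by (rule finite_sum_le_infsum[OF ell2_summable[OF assms]]) auto
  thus ?thesis unfolding ell2_sqn by (simp add: real_le_rsqrt)
qed

lemma L2_set_le_ell2_norm:
  assumes "u \<in> ell2" "finite F" shows "L2_set (\<lambda>n. cmod (u n)) F \<le> ell2_norm u"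
  unfolding ell2_sqn L2_set_def sqn_def
  by (intro real_sqrt_le_mono finite_sum_le_infsum[OF ell2_summable[OF assms(1)] assms(2)]) auto

lemma sqn_eq_0:
  assumes "u \<in> ell2" "sqn u \<le> 0" shows "u = (\<lambda>_. 0)"
proof
  fix n
  have "sqn u = 0" using assms(2) sqn_nonneg[of u] by simp
  hence "cmod (u n) \<le> 0" using cmod_le_ell2_norm[OF assms(1), of n] by (simp add: ell2_sqn)
  thus "u n = 0" by simp
qed

text \<open>Completeness of \<open>ell2\<close> for geometrically bounded series: on a finite window
  the triangle inequality bounds all partial sums by the geometric sum, and the bound passes to the
  pointwise limit.\<close>

lemma ell2_series:
  assumes x: "\<forall>k. x k \<in> ell2" and b: "\<forall>k. ell2_norm (x k) \<le> C * r ^ k" and r: "0 \<le> r" "r < 1"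
  shows "(\<lambda>k. x k n) sums (\<Sum>k. x k n)" "(\<lambda>n. \<Sum>k. x k n) \<in> ell2"
proof -
  have g: "summable (\<lambda>k. C * r ^ k)" using r by (intro summable_mult summable_geometric) simp
  have sm: "summable (\<lambda>k. x k n)" for n
    by (rule summable_comparison_test'[OF g, of 0]) (use cmod_le_ell2_norm x b in \<open>metis order_trans\<close>)
  show "(\<lambda>k. x k n) sums (\<Sum>k. x k n)" using sm summable_sums by blast
  have C: "C \<ge> 0" using spec[OF b, of 0] sqn_nonneg[of "x 0"] by (simp add: ell2_sqn) (metis order_trans real_sqrt_ge_zero)
  let ?u = "\<lambda>n. \<Sum>k. x k n"
  let ?S = "\<Sum>k. C * r ^ k"
  have fin: "L2_set (\<lambda>n. cmod (?u n)) F \<le> ?S" if F: "finite F" for F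
  proof -
    have part: "L2_set (\<lambda>n. cmod (\<Sum>k<K. x k n)) F \<le> (\<Sum>k<K. C * r ^ k)" for K
    proof (induction K)
      case (Suc K)
      have "L2_set (\<lambda>n. cmod (\<Sum>k<Suc K. x k n)) F \<le> L2_set (\<lambda>n. cmod (\<Sum>k<K. x k n) + cmod (x K n)) F"
        by (intro L2_set_mono) (auto intro: norm_triangle_ineq)
      also have "\<dots> \<le> L2_set (\<lambda>n. cmod (\<Sum>k<K. x k n)) F + L2_set (\<lambda>n. cmod (x K n)) F"
        by (rule L2_set_triangle_ineq)
      also have "\<dots> \<le> (\<Sum>k<K. C * r ^ k) + C * r ^ K"
        using Suc L2_set_le_ell2_norm[OF spec[OF x] F, of K] spec[OF b, of K] by linarith
      finally show ?case by simp
    qed (simp add: L2_set_def)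
    have "L2_set (\<lambda>n. cmod (\<Sum>k<K. x k n)) F \<le> ?S" for K
      by (rule order_trans[OF part sum_le_suminf[OF g]]) (use C r in auto)
    moreover have "(\<lambda>K. L2_set (\<lambda>n. cmod (\<Sum>k<K. x k n)) F) \<longlonglongrightarrow> L2_set (\<lambda>n. cmod (?u n)) F"
      unfolding L2_set_def by (intro tendsto_intros summable_LIMSEQ sm)
    ultimately show ?thesis by (intro LIMSEQ_le_const2) auto
  qed
  show "?u \<in> ell2"
    unfolding ell2_def mem_Collect_eq
  proof (rule nonneg_bdd_above_summable_on)
    show "bdd_above (sum (\<lambda>n. (cmod (?u n))\<^sup>2) ` {F. F \<subseteq> UNIV \<and> finite F})"
    proof (rule bdd_aboveI2)
      fix F :: "int set" assume F: "F \<in> {F. F \<subseteq> UNIV \<and> finite F}"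
      have "(\<Sum>n\<in>F. (cmod (?u n))\<^sup>2) = (L2_set (\<lambda>n. cmod (?u n)) F)\<^sup>2"
        unfolding L2_set_def by (simp add: sum_nonneg)
      also have "\<dots> \<le> ?S\<^sup>2" using fin F by (intro power_mono) auto
      finally show "(\<Sum>n\<in>F. (cmod (?u n))\<^sup>2) \<le> ?S\<^sup>2" .
    qed
  qed auto
qed

section \<open>Invertibility from a lower bound\<close>

lemma shifted_sums:
  assumes "\<And>n. (\<lambda>k. x k n) sums u n"
  shows "(\<lambda>k. shifted d E (x k) n) sums shifted d E u n"
  unfolding shifted_def jacobi_def by (intro sums_diff sums_add sums_mult assms)

lemma shifted_cnj: "shifted d (cnj E) u n = cnj (shifted d E (\<lambda>n. cnj (u n)) n)"
  by (simp add: shifted_def jacobi_def)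

lemma shifted_diff: "shifted d E (\<lambda>n. u n - v n) n = shifted d E u n - shifted d E v n"
  by (simp add: shifted_def jacobi_def algebra_simps)

lemma shifted_scale: "shifted d E (\<lambda>n. c * u n) n = c * shifted d E u n"
  by (simp add: shifted_def jacobi_def algebra_simps)

text \<open>Richardson iteration for the normal equation: \<open>1 - t A\<^sup>* A\<close> is a contraction for small \<open>t\<close>.\<close>

lemma shifted_surjective:
  assumes d: "\<forall>n. \<bar>d n\<bar> \<le> D" and c: "c > 0"
    and low: "\<forall>u\<in>ell2. c * sqn u \<le> sqn (shifted d E u)" and f: "f \<in> ell2"
  shows "\<exists>u\<in>ell2. shifted d E u = f"
proof -
  define A where "A = shifted d E"
  define A' where "A' = shifted d (cnj E)"
  \<comment> \<open>Bounds the squared norm of \<open>A'\<close>; the added c ensures c \<le> B, so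
    that the contraction factor q is nonnegative.\<close>
  define B where "B = 8 + 2 * (D + cmod E)\<^sup>2 + c"
  have B: "B > 0" "c \<le> B" using c by (auto simp: B_def add_nonneg_pos add_pos_nonneg)
  have A: "A u \<in> ell2" "A' u \<in> ell2" if "u \<in> ell2" for u
    using ell2_shifted(1)[OF d that] by (auto simp: A_def A'_def)
  have A'B: "sqn (A' u) \<le> B * sqn u" if "u \<in> ell2" for u
  proof -
    have "sqn (A' u) \<le> (8 + 2 * (D + cmod E)\<^sup>2) * sqn u"
      using ell2_shifted(2)[OF d that, of "cnj E"] by (simp add: A'_def)
    also have "\<dots> \<le> B * sqn u" using c sqn_nonneg by (intro mult_right_mono) (auto simp: B_def)
    finally show ?thesis .
  qed
  define T where "T = (\<lambda>u n. u n - of_real (1 / B) * A' (A u) n)"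
  define q where "q = 1 - c / B"
  have q: "0 \<le> q" "q < 1" using B c by (auto simp: q_def)
  have T: "T u \<in> ell2" if "u \<in> ell2" for u
    unfolding T_def by (intro ell2_diff ell2_scale A that)
  have Tq: "sqn (T u) \<le> q * sqn u" if u: "u \<in> ell2" for u
  proof -
    have "re_inner u (A' (A u)) = sqn (A u)"
      using shifted_adjoint[OF d u A(1)[OF u], of E] by (simp add: sqn_ip A_def A'_def)
    hence "sqn (T u) = sqn u - 2 * (1 / B) * sqn (A u) + (1 / B)\<^sup>2 * sqn (A' (A u))"
      unfolding T_def sqn_diff[OF u A(2)[OF A(1)[OF u]]] by simp
    also have "\<dots> \<le> sqn u - 2 * (1 / B) * sqn (A u) + (1 / B)\<^sup>2 * (B * sqn (A u))"
      using A'B[OF A(1)[OF u]] by (intro add_mono mult_left_mono) auto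
    also have "\<dots> = sqn u - sqn (A u) / B" using B by (simp add: power2_eq_square field_simps)
    also have "\<dots> \<le> sqn u - c * sqn u / B"
      using bspec[OF low, OF u] B by (simp add: A_def divide_right_mono)
    finally show ?thesis by (simp add: q_def algebra_simps)
  qed
  define x0 where "x0 = (\<lambda>n. of_real (1 / B) * A' f n)"
  define x where "x = (\<lambda>k. (T ^^ k) x0)"
  have x0: "x0 \<in> ell2" unfolding x0_def by (intro ell2_scale A f)
  have x: "x k \<in> ell2" for k by (induction k) (auto simp: x_def x0 T)
  have xq: "sqn (x k) \<le> sqn x0 * q ^ k" for k
  proof (induction k)
    case (Suc k)
    have "sqn (x (Suc k)) \<le> q * sqn (x k)" using Tq[OF x[of k]] by (simp add: x_def)
    also have "\<dots> \<le> q * (sqn x0 * q ^ k)" using Suc q by (intro mult_left_mono) auto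
    finally show ?case by (simp add: mult_ac)
  qed (simp add: x_def)
  have xb: "ell2_norm (x k) \<le> sqrt (sqn x0) * sqrt q ^ k" for k
    unfolding ell2_sqn using real_sqrt_le_mono[OF xq[of k]] by (simp add: real_sqrt_mult real_sqrt_power)
  have r: "0 \<le> sqrt q" "sqrt q < 1" using q by auto
  define u where "u = (\<lambda>n. \<Sum>k. x k n)"
  have us: "(\<lambda>k. x k n) sums u n" for n unfolding u_def by (rule ell2_series(1)[OF allI[OF x] allI[OF xb] r])
  have u: "u \<in> ell2" unfolding u_def by (rule ell2_series(2)[OF allI[OF x] allI[OF xb] r])
  have "A' (A u) n = A' f n" for n
  proof -
    have 1: "(\<lambda>k. A' (A (x k)) n) sums A' (A u) n"
      unfolding A_def A'_def by (intro shifted_sums us)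
    have "(\<lambda>k. x k n) \<longlonglongrightarrow> 0" using us sums_summable summable_LIMSEQ_zero by blast
    \<comment> \<open>Telescoping the iteration: each difference is A'A applied to the k-th term,
      divided by B, and the total is the first term.\<close>
    hence "(\<lambda>k. x k n - x (Suc k) n) sums (x 0 n - 0)" by (rule telescope_sums')
    moreover have "x k n - x (Suc k) n = of_real (1 / B) * A' (A (x k)) n" for k
      by (simp add: x_def T_def)
    ultimately have "(\<lambda>k. of_real (1 / B) * A' (A (x k)) n) sums x0 n" by (simp add: x_def)
    moreover have "(\<lambda>k. of_real (1 / B) * A' (A (x k)) n) sums (of_real (1 / B) * A' (A u) n)"
      by (intro sums_mult 1)
    ultimately have "of_real (1 / B) * A' (A u) n = x0 n" using sums_unique2 by blast
    thus ?thesis using B by (simp add: x0_def)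
  qed
  hence w0: "A' (\<lambda>n. A u n - f n) = (\<lambda>_. 0)" by (auto simp: A'_def shifted_diff fun_eq_iff)
  define w where "w = (\<lambda>n. A u n - f n)"
  have w: "w \<in> ell2" unfolding w_def by (intro ell2_diff A u f)
  \<comment> \<open>As d is real, conjugation carries the kernel of \<open>A'\<close> into that of
    \<open>A\<close>, where the lower bound applies.\<close>
  have cw: "(\<lambda>n. cnj (w n)) \<in> ell2" "sqn (\<lambda>n. cnj (w n)) = sqn w" using w by (auto simp: ell2_def sqn_def)
  have "cnj (shifted d E (\<lambda>n. cnj (w n)) n) = 0" for n
    using w0 unfolding w_def[symmetric] A'_def shifted_cnj[of d E w, symmetric] by simp
  hence "sqn (shifted d E (\<lambda>n. cnj (w n))) = 0" by (simp add: sqn_def)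
  hence "c * sqn w \<le> 0" using bspec[OF low, OF cw(1)] cw(2) by simp
  hence "sqn w \<le> 0" using c by (simp add: mult_le_0_iff)
  hence "w = (\<lambda>_. 0)" by (rule sqn_eq_0[OF w])
  hence "A u = f" by (auto simp: w_def fun_eq_iff)
  thus ?thesis using u by (auto simp: A_def)
qed

text \<open>The lower bound gives injectivity and bounds the inverse;
  \<open>shifted_surjective\<close> supplies the rest of a resolvent.\<close>

lemma not_in_spectrum:
  assumes d: "\<forall>n. \<bar>d n\<bar> \<le> D" and c: "c > 0"
    and low: "\<forall>u\<in>ell2. c * sqn u \<le> sqn (shifted d E u)"
  shows "E \<notin> op_spectrum (jacobi d)"
proof -
  \<comment> \<open>Values of \<open>G\<close> outside \<open>ell2\<close> are arbitrary; the
    resolvent is only tested on \<open>ell2\<close>.\<close>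
  define G where "G = (\<lambda>f. SOME u. u \<in> ell2 \<and> shifted d E u = f)"
  have G: "G f \<in> ell2" "shifted d E (G f) = f" if "f \<in> ell2" for f
    using someI_ex[of "\<lambda>u. u \<in> ell2 \<and> shifted d E u = f"] shifted_surjective[OF d c low that]
    unfolding G_def by blast+
  have inj: "G (shifted d E u) = u" if u: "u \<in> ell2" for u
  proof -
    note g = G[OF ell2_shifted(1)[OF d u], of E]
    have m: "(\<lambda>n. G (shifted d E u) n - u n) \<in> ell2" by (intro ell2_diff g u)
    have "sqn (shifted d E (\<lambda>n. G (shifted d E u) n - u n)) = 0"
      by (simp add: shifted_diff g sqn_def)
    hence "c * sqn (\<lambda>n. G (shifted d E u) n - u n) \<le> 0" using bspec[OF low, OF m] by simp
    hence "sqn (\<lambda>n. G (shifted d E u) n - u n) \<le> 0" using c by (simp add: mult_le_0_iff)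
    from sqn_eq_0[OF m this] show ?thesis by (simp add: fun_eq_iff)
  qed
  have bd: "ell2_norm (G f) \<le> (1 / sqrt c) * ell2_norm f" if "f \<in> ell2" for f
  proof -
    have "sqrt (c * sqn (G f)) \<le> sqrt (sqn f)"
      using bspec[OF low, OF G(1)[OF that]] G(2)[OF that] by (intro real_sqrt_le_mono) simp
    thus ?thesis using c by (simp add: ell2_sqn real_sqrt_mult field_simps)
  qed
  have e: "(\<lambda>n. jacobi d u n - E * u n) = shifted d E u" for u by (simp add: shifted_def fun_eq_iff)
  show ?thesis
    unfolding op_spectrum_def mem_Collect_eq not_not e
    using G inj bd by (intro exI[of _ G] conjI exI[of _ "1 / sqrt c"] ballI) auto
qed

text \<open>The operator minus Re E is symmetric, so its image of u is orthogonal, in the real inner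
  product, to i u; expanding the squared norm leaves no cross term.\<close>

lemma shifted_imaginary:
  assumes d: "\<forall>n. \<bar>d n\<bar> \<le> D" and u: "u \<in> ell2"
  shows "(Im E)\<^sup>2 * sqn u \<le> sqn (shifted d E u)"
proof -
  define X where "X = shifted d (of_real (Re E)) u"
  define w where "w = (\<lambda>n. \<i> * u n)"
  have X: "X \<in> ell2" unfolding X_def by (rule ell2_shifted(1)[OF d u])
  have w: "w \<in> ell2" unfolding w_def by (rule ell2_scale[OF u])
  have "shifted d E u n = X n - of_real (Im E) * w n" for n
  proof -
    have "E * u n = (of_real (Re E) + of_real (Im E) * \<i>) * u n"
      by (metis complex_eq mult.commute)
    thus ?thesis by (simp add: X_def w_def shifted_def algebra_simps)
  qed
  hence "shifted d E u = (\<lambda>n. X n - of_real (Im E) * w n)" by (rule ext)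
  hence e: "sqn (shifted d E u) = sqn X - 2 * Im E * re_inner X w + (Im E)\<^sup>2 * sqn w"
    by (simp only: sqn_diff[OF X w])
  have "re_inner X w = re_inner u (\<lambda>n. \<i> * X n)"
    using shifted_adjoint[OF d u w, of "of_real (Re E)"] unfolding X_def w_def
    by (simp add: shifted_scale[abs_def])
  also have "\<dots> = - re_inner X w"
    unfolding re_inner_def w_def by (subst infsum_uminus[symmetric]) (auto intro!: infsum_cong simp: algebra_simps)
  finally have "re_inner X w = 0" by simp
  moreover have "sqn w = sqn u" by (simp add: sqn_def w_def norm_mult)
  ultimately show ?thesis using e sqn_nonneg[of X] by simp
qed

lemma spectrum_real:
  assumes d: "\<forall>n. \<bar>d n\<bar> \<le> D" and "E \<in> op_spectrum (jacobi d)"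
  shows "Im E = 0"
proof (rule ccontr)
  assume "Im E \<noteq> 0"
  hence "E \<notin> op_spectrum (jacobi d)"
    by (intro not_in_spectrum[OF d, of "(Im E)\<^sup>2"] ballI shifted_imaginary[OF d]) simp_all
  thus False using assms(2) by blast
qed

text \<open>A point of the spectrum defeats the lower bound of \<open>not_in_spectrum\<close>.
  Truncating the resulting vector to a large finite set changes both sides little.\<close>

lemma weyl_vector:
  assumes d: "\<forall>n. \<bar>d n\<bar> \<le> D" and E: "E \<in> op_spectrum (jacobi d)" and c: "c > 0"
  shows "\<exists>u F. finite F \<and> (\<forall>n. n \<notin> F \<longrightarrow> u n = 0) \<and> u \<in> ell2 \<and> sqn (shifted d E u) < c * sqn u"
proof -
  define B where "B = 8 + 2 * (D + cmod E)\<^sup>2"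
  have B: "B > 0" by (auto simp: B_def add_pos_nonneg)
  have "\<exists>u\<in>ell2. \<not> c / 8 * sqn u \<le> sqn (shifted d E u)"
    using not_in_spectrum[OF d, of "c / 8" E] E c by auto
  then obtain u where u: "u \<in> ell2" "sqn (shifted d E u) < c / 8 * sqn u" by auto
  have pos: "sqn u > 0"
    using u(2) sqn_nonneg[of "shifted d E u"] sqn_nonneg[of u] by (cases "sqn u = 0") auto
  \<comment> \<open>Cutting off mass \<delta> keeps half of the mass of u and, by the operator bound
    B, adds an image of squared norm at most \<open>c / 8 * sqn u\<close>. Together with the c/8
    above this gives 2(c/8 + c/8) = c/2.\<close>
  define \<delta> where "\<delta> = min (1/2) (c / (8 * B)) * sqn u"
  have \<delta>: "\<delta> > 0" "\<delta> \<le> sqn u / 2" "\<delta> \<le> c / (8 * B) * sqn u"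
    using pos B c by (auto simp: \<delta>_def min_mult_distrib_right)
  obtain F where F: "finite F" "sqn u - \<delta> \<le> (\<Sum>n\<in>F. (cmod (u n))\<^sup>2)"
  proof -
    have "((\<lambda>n. (cmod (u n))\<^sup>2) has_sum sqn u) UNIV"
      unfolding sqn_def by (rule has_sum_infsum[OF ell2_summable[OF u(1)]])
    hence "eventually (\<lambda>F. (\<Sum>n\<in>F. (cmod (u n))\<^sup>2) > sqn u - \<delta>) (finite_subsets_at_top UNIV)"
      unfolding has_sum_def using \<delta>(1) by (intro order_tendstoD) auto
    then obtain F where "finite F" "(\<Sum>n\<in>F. (cmod (u n))\<^sup>2) > sqn u - \<delta>"
      by (auto simp: eventually_finite_subsets_at_top)
    thus ?thesis using that by force
  qed
  define v where "v = (\<lambda>n. if n \<in> F then u n else 0)"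
  define w where "w = (\<lambda>n. v n - u n)"
  have v: "v \<in> ell2" using ell2_dominated(1)[OF ell2_summable[OF u(1)], of v] by (auto simp: v_def)
  have w: "w \<in> ell2" unfolding w_def by (rule ell2_diff[OF v u(1)])
  have sv: "sqn v = (\<Sum>n\<in>F. (cmod (u n))\<^sup>2)"
  proof -
    have "sqn v = (\<Sum>\<^sub>\<infinity>n\<in>F. (cmod (u n))\<^sup>2)"
      unfolding sqn_def by (intro infsum_cong_neutral) (auto simp: v_def)
    thus ?thesis using F(1) by simp
  qed
  have "(cmod (u n))\<^sup>2 = (cmod (v n))\<^sup>2 + (cmod (w n))\<^sup>2" for n by (simp add: v_def w_def)
  hence "sqn u = (\<Sum>\<^sub>\<infinity>n. (cmod (v n))\<^sup>2 + (cmod (w n))\<^sup>2)" by (simp only: sqn_def)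
  also have "\<dots> = sqn v + sqn w" unfolding sqn_def by (intro infsum_add ell2_summable v w)
  finally have "sqn u = sqn v + sqn w" .
  hence sw: "sqn w \<le> \<delta>" using sv F(2) by simp
  have half: "sqn v \<ge> sqn u / 2" using sv F(2) \<delta>(2) by linarith
  have e: "shifted d E v = (\<lambda>n. shifted d E u n + shifted d E w n)"
    by (auto simp: shifted_def jacobi_def w_def algebra_simps)
  note su = ell2_shifted[OF d u(1), of E] and swd = ell2_shifted[OF d w, of E]
  have "sqn (shifted d E v) \<le> 2 * sqn (shifted d E u) + 2 * sqn (shifted d E w)"
    unfolding e by (rule ell2_add(2)[OF su(1) swd(1)])
  also have "sqn (shifted d E w) \<le> B * sqn w" using swd(2) by (simp add: B_def)
  also have "B * sqn w \<le> B * (c / (8 * B) * sqn u)"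
    using sw \<delta>(3) B by (intro mult_left_mono) auto
  also have "B * (c / (8 * B) * sqn u) = c / 8 * sqn u" using B by simp
  finally have "sqn (shifted d E v) < 2 * (c / 8 * sqn u) + 2 * (c / 8 * sqn u)" using u(2) by simp
  also have "\<dots> = c * (sqn u / 2)" by simp
  also have "\<dots> \<le> c * sqn v" using half c by (intro mult_left_mono) auto
  finally have "sqn (shifted d E v) < c * sqn v" .
  moreover have "\<forall>n. n \<notin> F \<longrightarrow> v n = 0" by (simp add: v_def)
  ultimately show ?thesis using F(1) v by blast
qed

text \<open>Real and imaginary parts split both sides of the inequality, so one of them satisfies
  it. The window has one site more than the support at each end, where the image can still be
  nonzero.\<close>

lemma weyl_vector_real:
  assumes d: "\<forall>n. \<bar>d n\<bar> \<le> D" and E: "of_real e \<in> op_spectrum (jacobi d)" and c: "c > 0"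
  obtains v :: "int \<Rightarrow> real" and s :: int and m :: nat where
    "\<And>n. n \<notin> {s+1..s+int m} \<Longrightarrow> v n = 0"
    "(\<Sum>n\<in>{s..s+int m+1}. (v (n+1) + v (n-1) + d n * v n - e * v n)\<^sup>2) < c * (\<Sum>n\<in>{s..s+int m+1}. (v n)\<^sup>2)"
proof -
  obtain u F where F: "finite F" "\<forall>n. n \<notin> F \<longrightarrow> u n = 0"
    and u: "u \<in> ell2" "sqn (shifted d (of_real e) u) < c * sqn u"
    using weyl_vector[OF d E c] by (elim exE conjE)
  define N where "N = Max (insert 0 (abs ` F))"
  have N: "\<And>n. n \<in> F \<Longrightarrow> \<bar>n\<bar> \<le> N" "N \<ge> 0"
    using F(1) by (auto simp: N_def)
  \<comment> \<open>Chosen so that {s+1..s+m} is {-N..N}.\<close>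
  define s where "s = - N - 1"
  define m where "m = nat (2 * N + 1)"
  have m: "int m = 2 * N + 1" using N(2) by (simp add: m_def)
  have u0: "u n = 0" if "n \<notin> {s+1..s+int m}" for n
    using that F(2) N(1)[of n] m by (cases "n \<in> F") (auto simp: s_def)
  let ?I = "{s..s+int m+1}"
  have fin: "sqn x = (\<Sum>n\<in>?I. (cmod (x n))\<^sup>2)" if "\<And>n. n \<notin> ?I \<Longrightarrow> x n = 0" for x
  proof -
    have "sqn x = (\<Sum>\<^sub>\<infinity>n\<in>?I. (cmod (x n))\<^sup>2)"
      unfolding sqn_def using that by (intro infsum_cong_neutral) auto
    thus ?thesis by simp
  qed
  let ?Q = "\<lambda>v n. v (n+1) + v (n-1) + d n * v n - e * v n :: real"
  have out: "shifted d (of_real e) u n = 0" if "n \<notin> ?I" for n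
  proof -
    have "u (n + 1) = 0" "u (n - 1) = 0" "u n = 0" using that by (auto intro!: u0)
    thus ?thesis by (simp add: shifted_def jacobi_def)
  qed
  have "(cmod (shifted d (of_real e) u n))\<^sup>2 = (?Q (\<lambda>n. Re (u n)) n)\<^sup>2 + (?Q (\<lambda>n. Im (u n)) n)\<^sup>2" for n
    by (simp add: cmod_power2 shifted_def jacobi_def)
  hence 1: "sqn (shifted d (of_real e) u) = (\<Sum>n\<in>?I. (?Q (\<lambda>n. Re (u n)) n)\<^sup>2) + (\<Sum>n\<in>?I. (?Q (\<lambda>n. Im (u n)) n)\<^sup>2)"
    using fin[OF out] by (simp add: sum.distrib)
  have 2: "sqn u = (\<Sum>n\<in>?I. (Re (u n))\<^sup>2) + (\<Sum>n\<in>?I. (Im (u n))\<^sup>2)"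
  proof -
    have "u n = 0" if "n \<notin> ?I" for n using that by (intro u0) auto
    from fin[OF this] show ?thesis by (simp add: cmod_power2 sum.distrib)
  qed
  have "(\<Sum>n\<in>?I. (?Q (\<lambda>n. Re (u n)) n)\<^sup>2) < c * (\<Sum>n\<in>?I. (Re (u n))\<^sup>2)
      \<or> (\<Sum>n\<in>?I. (?Q (\<lambda>n. Im (u n)) n)\<^sup>2) < c * (\<Sum>n\<in>?I. (Im (u n))\<^sup>2)"
    using u(2) unfolding 1 2 distrib_left by linarith
  thus ?thesis using that[of s m "\<lambda>n. Re (u n)"] that[of s m "\<lambda>n. Im (u n)"] u0 by auto
qed

section \<open>Periodic approximants\<close>

definition hill :: "(int \<Rightarrow> real) \<Rightarrow> real \<Rightarrow> (int \<Rightarrow> real) \<Rightarrow> int \<Rightarrow> real" where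
  "hill d e v n = v (n+1) + v (n-1) + d n * v n - e * v n"

definition periodic :: "int \<Rightarrow> (int \<Rightarrow> real) \<Rightarrow> bool" where
  "periodic l v \<longleftrightarrow> (\<forall>n. v (n + l) = v n)"

definition dot :: "int \<Rightarrow> (int \<Rightarrow> real) \<Rightarrow> (int \<Rightarrow> real) \<Rightarrow> real" where
  "dot l u v = (\<Sum>n\<in>{0..<l}. u n * v n)"

lemma periodic_mod:
  assumes "periodic l v" shows "v (n mod l) = v n"
proof -
  have nat: "v (n + int k * l) = v n" for n k
  proof (induction k)
    case (Suc k)
    have "v (n + int (Suc k) * l) = v ((n + int k * l) + l)" by (simp add: algebra_simps)
    thus ?case using Suc assms by (simp add: periodic_def)
  qed simp
  have "v (n + k * l) = v n" for n k
  proof (cases "k \<ge> 0")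
    case True thus ?thesis using nat[of n "nat k"] by simp
  next
    case False
    thus ?thesis using nat[of "n + k * l" "nat (- k)"] by simp
  qed
  from this[of "n mod l" "n div l"] show ?thesis by (metis mod_div_mult_eq)
qed

lemma periodic_hill:
  assumes "periodic l d" "periodic l v" shows "periodic l (hill d e v)"
proof -
  have "v (n + l + 1) = v (n + 1)" "v (n + l - 1) = v (n - 1)" for n
    using assms(2) unfolding periodic_def by (metis add.commute add.left_commute, metis add_diff_eq add.commute diff_add_eq)
  thus ?thesis using assms by (simp add: periodic_def hill_def)
qed

lemma periodic_linear:
  "periodic l u \<Longrightarrow> periodic l v \<Longrightarrow> periodic l (\<lambda>n. a * u n + b * v n)"
  by (simp add: periodic_def)

lemma hill_linear: "hill d e (\<lambda>n. a * u n + b * v n) n = a * hill d e u n + b * hill d e v n"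
  by (simp add: hill_def algebra_simps)

lemma sum_periodic_shift:
  assumes "periodic l f" "l > 0"
  shows "(\<Sum>n\<in>{0..<l}. f (n + 1)) = (\<Sum>n\<in>{0..<l}. f n)"
proof -
  have "(\<Sum>n\<in>{0..<l}. f (n + 1)) = (\<Sum>n\<in>{1..<l+1}. f n)"
    by (rule sum.reindex_bij_witness[of _ "\<lambda>n. n - 1" "\<lambda>n. n + 1"]) auto
  also have "{1..<l+1} = insert l {1..<l}" using assms(2) by auto
  also have "(\<Sum>n\<in>insert l {1..<l}. f n) = f l + (\<Sum>n\<in>{1..<l}. f n)" by simp
  also have "f l = f 0" using assms(1) by (metis add_0 periodic_def)
  also have "f 0 + (\<Sum>n\<in>{1..<l}. f n) = (\<Sum>n\<in>insert 0 {1..<l}. f n)" by simp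
  also have "insert 0 {1..<l} = {0..<l}" using assms(2) by auto
  finally show ?thesis .
qed

lemma dot_linear: "dot l (\<lambda>n. a * u n + b * v n) w = a * dot l u w + b * dot l v w"
  by (simp add: dot_def sum.distrib sum_distrib_left algebra_simps)

lemma dot_nonneg: "dot l v v \<ge> 0"
  unfolding dot_def by (intro sum_nonneg) simp

lemma dot_eq_0:
  assumes "periodic l v" "l > 0" "dot l v v = 0" shows "v n = 0"
proof -
  have "\<forall>n\<in>{0..<l}. v n * v n = 0"
    using assms(3) unfolding dot_def by (subst (asm) sum_nonneg_eq_0_iff) auto
  moreover have "n mod l \<in> {0..<l}" using assms(2) by simp
  ultimately have "v (n mod l) = 0" by auto
  thus ?thesis using periodic_mod[OF assms(1)] by simp
qed

lemma hill_symmetric: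
  assumes "periodic l u" "periodic l v" "l > 0"
  shows "dot l (hill d e u) v = dot l u (hill d e v)"
proof -
  have per: "periodic l (\<lambda>n. x n * y (n - 1))" if "periodic l x" "periodic l y" for x y
    using that unfolding periodic_def by (metis add_diff_eq add.commute diff_add_eq)
  have *: "(\<Sum>n\<in>{0..<l}. x (n + 1) * y n) = (\<Sum>n\<in>{0..<l}. x n * y (n - 1))"
    if "periodic l x" "periodic l y" for x y
    using sum_periodic_shift[OF per[OF that] assms(3)] by simp
  have "dot l (hill d e u) v = (\<Sum>n\<in>{0..<l}. u (n + 1) * v n) + (\<Sum>n\<in>{0..<l}. v n * u (n - 1))
      + (\<Sum>n\<in>{0..<l}. (d n - e) * (u n * v n))"
    unfolding dot_def hill_def sum.distrib[symmetric] by (intro sum.cong) (auto simp: algebra_simps)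
  also have "\<dots> = (\<Sum>n\<in>{0..<l}. u n * v (n - 1)) + (\<Sum>n\<in>{0..<l}. v (n + 1) * u n)
      + (\<Sum>n\<in>{0..<l}. (d n - e) * (u n * v n))"
    using *[OF assms(1,2)] *[OF assms(2,1)] by simp
  also have "\<dots> = dot l u (hill d e v)"
    unfolding dot_def hill_def sum.distrib[symmetric] by (intro sum.cong) (auto simp: algebra_simps)
  finally show ?thesis .
qed

text \<open>First-order condition at a minimum: for small s of sign opposite to a, the linear term
  would dominate.\<close>

lemma linear_coefficient_zero:
  fixes a b :: real
  assumes "\<And>s. 2 * s * a + s\<^sup>2 * b \<ge> 0" shows "a = 0"
proof (rule ccontr)
  assume a: "a \<noteq> 0"
  define t where "t = 1 / (1 + \<bar>b\<bar>)"
  have t: "t > 0" "t * \<bar>b\<bar> < 1" by (auto simp: t_def field_simps)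
  have "2 * (- a * t) * a + (- a * t)\<^sup>2 * b = (a\<^sup>2 * t) * (t * b - 2)"
    by (simp add: power2_eq_square algebra_simps)
  moreover have "t * b \<le> t * \<bar>b\<bar>" using t(1) by (intro mult_left_mono) auto
  moreover have "a\<^sup>2 * t > 0" using a t by simp
  ultimately show False using assms[of "- a * t"] t(2) by (smt (verit) mult_pos_neg)
qed

lemma continuous_on_hill: "continuous_on S (\<lambda>v. hill d e v n)"
  unfolding hill_def
  by (intro continuous_intros continuous_on_subset[OF continuous_on_product_coordinates] subset_UNIV)

text \<open>Periodic sequences are kept as functions on all integers with the product topology; the
  sphere is then a closed subset of the cube of sequences in [-1, 1], compact by Tychonoff.\<close>

lemma compact_periodic_sphere:
  assumes "l > 0" shows "compact {v. periodic l v \<and> dot l v v = 1}"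
proof -
  let ?S = "{v. periodic l v \<and> dot l v v = 1}"
  have "compactin (product_topology (\<lambda>i::int. euclidean) UNIV) (PiE UNIV (\<lambda>i. {-1..1::real}))"
    by (subst compactin_PiE) (auto simp: compactin_euclidean_iff)
  hence cube: "compact (PiE UNIV (\<lambda>i::int. {-1..1::real}))"
    by (simp add: euclidean_product_topology[symmetric] compactin_euclidean_iff[symmetric])
  have "closed {v::int\<Rightarrow>real. periodic l v}"
    unfolding periodic_def
    by (intro closed_Collect_all closed_Collect_eq continuous_intros continuous_on_product_coordinates)
  moreover have "closed {v::int\<Rightarrow>real. dot l v v = 1}"
    unfolding dot_def
    by (intro closed_Collect_eq continuous_intros continuous_on_product_coordinates)
  ultimately have cl: "closed ?S" by (simp add: closed_Collect_conj)
  have sub: "?S \<subseteq> PiE UNIV (\<lambda>i. {-1..1})"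
  proof safe
    fix v :: "int \<Rightarrow> real" and n assume v: "periodic l v" "dot l v v = 1"
    have "v (n mod l) * v (n mod l) \<le> dot l v v"
      unfolding dot_def using assms by (intro member_le_sum) auto
    hence "(v n)\<^sup>2 \<le> 1" using v by (simp add: periodic_mod power2_eq_square)
    thus "v n \<in> {-1..1}" using abs_square_le_1[of "v n"] by auto
  qed auto
  have "PiE UNIV (\<lambda>i. {-1..1}) \<inter> ?S = ?S" using sub by (rule Int_absorb1)
  thus ?thesis using compact_Int_closed[OF cube cl] by simp
qed

text \<open>A variational substitute for the spectral theorem: the Rayleigh quotient of the squared
  operator attains its minimum m on the unit sphere, and the Euler equation makes the minimizer an
  eigenvector of the square.\<close>

lemma hill_square_minimizer:
  assumes l: "l > 0" and d: "periodic l d" and w: "periodic l w" and c: "dot l (hill d e w) (hill d e w) < c * dot l w w"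
  obtains v m where "periodic l v" "dot l v v = 1" "0 \<le> m" "m < c" "\<And>n. hill d e (hill d e v) n = m * v n"
proof -
  let ?H = "hill d e"
  let ?S = "{v. periodic l v \<and> dot l v v = 1}"
  let ?F = "\<lambda>v. dot l (?H v) (?H v)"
  have scale2: "dot l (\<lambda>n. a * u n) (\<lambda>n. a * u n) = a\<^sup>2 * dot l u u" for a u
    by (simp add: dot_def sum_distrib_left power2_eq_square mult_ac)
  have "?H (\<lambda>n. a * u n) = (\<lambda>n. a * ?H u n)" for a u
    by (rule ext) (simp add: hill_def algebra_simps)
  hence scale1: "?F (\<lambda>n. a * u n) = a\<^sup>2 * ?F u" for a u by (simp only: scale2)
  have scale3: "periodic l u \<Longrightarrow> periodic l (\<lambda>n. a * u n)" for a u
    by (simp add: periodic_def)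
  have unit: "(\<lambda>n. (1 / sqrt (dot l u u)) * u n) \<in> ?S" "?F (\<lambda>n. (1 / sqrt (dot l u u)) * u n) = ?F u / dot l u u"
    if "periodic l u" "dot l u u \<noteq> 0" for u
  proof -
    have sq: "(1 / sqrt (dot l u u))\<^sup>2 = 1 / dot l u u" using dot_nonneg[of l u] by (simp add: power_divide)
    show "(\<lambda>n. (1 / sqrt (dot l u u)) * u n) \<in> ?S"
      unfolding mem_Collect_eq scale2 sq
      using scale3[OF that(1), of "1 / sqrt (dot l u u)"] that(2) by simp
    show "?F (\<lambda>n. (1 / sqrt (dot l u u)) * u n) = ?F u / dot l u u"
      unfolding scale1 sq by simp
  qed
  have w0: "dot l w w \<noteq> 0" using c dot_nonneg[of l "?H w"] by auto
  have "continuous_on ?S ?F"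
    unfolding dot_def by (intro continuous_intros continuous_on_hill)
  then obtain v where v: "v \<in> ?S" "\<And>u. u \<in> ?S \<Longrightarrow> ?F v \<le> ?F u"
    using continuous_attains_inf[OF compact_periodic_sphere[OF l], of ?F] unit(1)[OF w w0] by blast
  define m where "m = ?F v"
  have vp: "periodic l v" "dot l v v = 1" using v(1) by auto
  have low: "m * dot l u u \<le> ?F u" if "periodic l u" for u
  proof (cases "dot l u u = 0")
    case True thus ?thesis using dot_nonneg[of l "?H u"] by simp
  next
    case False
    have "m \<le> ?F u / dot l u u"
      using v(2)[OF unit(1)[OF that False]] unfolding unit(2)[OF that False] m_def .
    thus ?thesis using False dot_nonneg[of l u] by (simp add: field_simps)
  qed
  have m: "0 \<le> m" unfolding m_def by (rule dot_nonneg)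
  have "m * dot l w w < c * dot l w w" using low[OF w] c by linarith
  hence mc: "m < c" using dot_nonneg[of l w] by (simp add: mult_less_cancel_right)
  have euler: "dot l (?H v) (?H h) = m * dot l v h" if h: "periodic l h" for h
  proof -
    have "2 * s * (dot l (?H v) (?H h) - m * dot l v h) + s\<^sup>2 * (?F h - m * dot l h h) \<ge> 0" for s
    proof -
      define u where "u = (\<lambda>n. 1 * v n + s * h n)"
      have Hu: "?H u = (\<lambda>n. 1 * ?H v n + s * ?H h n)" unfolding u_def by (rule ext) (rule hill_linear)
      have sq: "dot l (\<lambda>n. 1 * x n + s * y n) (\<lambda>n. 1 * x n + s * y n) = dot l x x + 2 * s * dot l x y + s\<^sup>2 * dot l y y" for x y
        by (simp add: dot_def sum.distrib sum_distrib_left power2_eq_square algebra_simps)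
      have "periodic l u" unfolding u_def by (rule periodic_linear[OF vp(1) h])
      from low[OF this] show ?thesis
        unfolding Hu sq unfolding u_def sq using vp(2) by (simp add: m_def[symmetric] algebra_simps)
    qed
    hence "dot l (?H v) (?H h) - m * dot l v h = 0" by (rule linear_coefficient_zero)
    thus ?thesis by simp
  qed
  \<comment> \<open>Testing the Euler equation in the direction of its own defect shows that the
    defect has norm zero.\<close>
  define h where "h = (\<lambda>n. 1 * ?H (?H v) n + (- m) * v n)"
  have Hp: "periodic l (?H v)" "periodic l (?H (?H v))" using periodic_hill d vp(1) by blast+
  have h: "periodic l h" unfolding h_def by (rule periodic_linear[OF Hp(2) vp(1)])
  have "dot l h h = dot l (?H (?H v)) h - m * dot l v h"
    unfolding h_def by (subst dot_linear) simp
  also have "dot l (?H (?H v)) h = dot l (?H v) (?H h)" by (rule hill_symmetric[OF Hp(1) h l])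
  finally have "dot l h h = 0" using euler[OF h] by simp
  hence "h n = 0" for n by (rule dot_eq_0[OF h l])
  hence "?H (?H v) n = m * v n" for n by (simp add: h_def)
  thus ?thesis using that vp m mc by blast
qed

text \<open>With \<mu>^2 = m, factor H^2 - m as (H - \<mu>)(H + \<mu>): either u = (H + \<mu>)v is
  nonzero and an eigenvector for \<mu>, or v is one for -\<mu>.\<close>

lemma hill_eigenfunction:
  assumes l: "l > 0" and d: "periodic l d" and w: "periodic l w" and \<epsilon>: "\<epsilon> > 0"
    and c: "dot l (hill d e w) (hill d e w) < \<epsilon>\<^sup>2 * dot l w w"
  obtains e' v n where "\<bar>e' - e\<bar> < \<epsilon>" "periodic l v" "v n \<noteq> 0" "\<And>n. hill d e' v n = 0"
proof -
  obtain v m where v: "periodic l v" "dot l v v = 1" "0 \<le> m" "m < \<epsilon>\<^sup>2" "\<And>n. hill d e (hill d e v) n = m * v n"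
    using hill_square_minimizer[OF l d w c] by blast
  define \<mu> where "\<mu> = sqrt m"
  have \<mu>: "\<mu> * \<mu> = m" "0 \<le> \<mu>" using v(3) by (auto simp: \<mu>_def)
  have \<mu>\<epsilon>: "\<mu> < \<epsilon>" using v(4) \<epsilon> by (simp add: \<mu>_def real_less_lsqrt)
  have shift: "hill d (e + t) u n = hill d e u n - t * u n" for t u n by (simp add: hill_def algebra_simps)
  define u where "u = (\<lambda>n. 1 * hill d e v n + \<mu> * v n)"
  show ?thesis
  proof (cases "\<exists>n. u n \<noteq> 0")
    case True
    then obtain n where "u n \<noteq> 0" by blast
    moreover have "periodic l u" unfolding u_def by (rule periodic_linear[OF periodic_hill[OF d v(1)] v(1)])
    moreover have "hill d (e + \<mu>) u n = 0" for n
      unfolding shift unfolding u_def hill_linear v(5) using \<mu>(1) by (simp add: algebra_simps)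
    ultimately show ?thesis using that[of "e + \<mu>" u] \<mu>(2) \<mu>\<epsilon> by simp
  next
    case False
    have "\<exists>n. v n \<noteq> 0"
    proof (rule ccontr)
      assume "\<nexists>n. v n \<noteq> 0"
      hence "dot l v v = 0" by (simp add: dot_def)
      thus False using v(2) by simp
    qed
    then obtain n where "v n \<noteq> 0" by blast
    moreover have "hill d (e + - \<mu>) v n = 0" for n
      unfolding shift using False by (simp add: u_def)
    ultimately show ?thesis using that[of "e + - \<mu>" v] v(1) \<mu>(2) \<mu>\<epsilon> by simp
  qed
qed

text \<open>Read the equation at a site where |v| is maximal.\<close>

lemma eigenvalue_bound:
  assumes l: "l > 0" and v: "periodic l v" "v n0 \<noteq> 0" and ev: "\<And>n. hill d e v n = 0" and d: "\<And>n. \<bar>d n\<bar> \<le> D"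
  shows "\<bar>e\<bar> \<le> 2 + D"
proof -
  let ?M = "Max ((\<lambda>n. \<bar>v n\<bar>) ` {0..<l})"
  have "?M \<in> (\<lambda>n. \<bar>v n\<bar>) ` {0..<l}" using l by (intro Max_in) auto
  then obtain n where n: "\<bar>v n\<bar> = ?M" by auto
  have le: "\<bar>v k\<bar> \<le> \<bar>v n\<bar>" for k
  proof -
    have "\<bar>v (k mod l)\<bar> \<le> ?M" using l by (intro Max_ge) auto
    thus ?thesis using n periodic_mod[OF v(1)] by simp
  qed
  have pos: "\<bar>v n\<bar> > 0" using le[of n0] v(2) by linarith
  have "e * v n = v (n+1) + v (n-1) + d n * v n" using ev[of n] by (simp add: hill_def)
  hence "\<bar>e\<bar> * \<bar>v n\<bar> = \<bar>v (n+1) + v (n-1) + d n * v n\<bar>" by (metis abs_mult)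
  also have "\<dots> \<le> \<bar>v (n+1)\<bar> + \<bar>v (n-1)\<bar> + \<bar>d n\<bar> * \<bar>v n\<bar>"
    using abs_mult[of "d n" "v n"] by linarith
  also have "\<dots> \<le> \<bar>v n\<bar> + \<bar>v n\<bar> + D * \<bar>v n\<bar>"
    by (intro add_mono le mult_right_mono d) simp
  finally have "\<bar>e\<bar> * \<bar>v n\<bar> \<le> (2 + D) * \<bar>v n\<bar>" by (simp add: algebra_simps)
  thus ?thesis using pos by simp
qed

section \<open>Real transfer matrices and wrapped eigenvectors\<close>

definition rstep :: "real \<Rightarrow> real \<Rightarrow> bool \<Rightarrow> real^2^2" where
  "rstep lam e b = vector [vector [e - lam * of_bool b, -1], vector [1, 0]]"

fun rmat :: "real \<Rightarrow> real \<Rightarrow> bool list \<Rightarrow> real^2^2" where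
  "rmat lam e [] = mat 1"
| "rmat lam e (b # w) = rmat lam e w ** rstep lam e b"

lemma rmat_append: "rmat lam e (u @ v) = rmat lam e v ** rmat lam e u"
  by (induction u) (auto simp: matrix_mul_assoc)

lemma det_rmat: "det (rmat lam e w) = 1"
proof (induction w)
  case (Cons b w)
  have "det (rstep lam e b) = 1" by (simp add: rstep_def det_2 vector_2)
  thus ?case using Cons by (simp add: det_mul)
qed simp

text \<open>The eigenvalue 1 and determinant 1 leave the characteristic polynomial at 1, which is 2
  - trace M, equal to zero.\<close>

lemma fixed_vector_trace:
  assumes "det (M::real^2^2) = 1" "M *v x = x" "x \<noteq> 0" shows "trace M = 2"
proof -
  have e1: "M$1$1 * x$1 + M$1$2 * x$2 = x$1" and e2: "M$2$1 * x$1 + M$2$2 * x$2 = x$2"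
    using assms(2) by (auto simp: vec_eq_iff forall_2 matrix_vector_mult_def sum_2)
  have d: "M$1$1 * M$2$2 - M$1$2 * M$2$1 = 1" using assms(1) by (simp add: det_2)
  have "(2 - trace M) * x$1 = (M$2$2 - 1) * (M$1$1 * x$1 + M$1$2 * x$2 - x$1)
      - M$1$2 * (M$2$1 * x$1 + M$2$2 * x$2 - x$2) + (1 - (M$1$1 * M$2$2 - M$1$2 * M$2$1)) * x$1"
    by (simp add: trace_2 algebra_simps)
  hence "(2 - trace M) * x$1 = 0" unfolding e1 e2 d by simp
  moreover have "(2 - trace M) * x$2 = (M$1$1 - 1) * (M$2$1 * x$1 + M$2$2 * x$2 - x$2)
      - M$2$1 * (M$1$1 * x$1 + M$1$2 * x$2 - x$1) + (1 - (M$1$1 * M$2$2 - M$1$2 * M$2$1)) * x$2"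
    by (simp add: trace_2 algebra_simps)
  hence "(2 - trace M) * x$2 = 0" unfolding e1 e2 d by simp
  moreover have "x$1 \<noteq> 0 \<or> x$2 \<noteq> 0" using assms(3) by (auto simp: vec_eq_iff forall_2)
  ultimately show ?thesis by auto
qed

lemma rmat_propagates:
  assumes "\<And>n. hill d e v n = 0" "\<And>i. i < length w \<Longrightarrow> d (n + int i) = lam * of_bool (w ! i)"
  shows "rmat lam e w *v (vector [v n, v (n - 1)] :: real^2) = vector [v (n + int (length w)), v (n + int (length w) - 1)]"
  using assms(2)
proof (induction w arbitrary: n)
  case (Cons b w)
  have b: "d n = lam * of_bool b" using Cons.prems[of 0] by simp
  have "v (n + 1) = (e - lam * of_bool b) * v n - v (n - 1)"
    using assms(1)[of n] b by (simp add: hill_def algebra_simps)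
  hence "rstep lam e b *v (vector [v n, v (n - 1)] :: real^2) = vector [v (n + 1), v (n + 1 - 1)]"
    by (simp add: rstep_def vec_eq_iff forall_2 matrix_vector_mult_def sum_2 vector_2)
  moreover have "rmat lam e w *v (vector [v (n + 1), v (n + 1 - 1)] :: real^2) = vector [v (n + 1 + int (length w)), v (n + 1 + int (length w) - 1)]"
    using Cons.prems[of "Suc _"] by (intro Cons.IH) (simp add: algebra_simps)
  ultimately show ?case by (simp add: matrix_vector_mul_assoc[symmetric] algebra_simps)
qed simp

lemma hill_zero:
  assumes "\<And>n. hill d e v n = 0" "v m = 0" "v (m - 1) = 0" shows "v n = 0"
proof -
  have r: "v (n + 1) = (e - d n) * v n - v (n - 1)" for n
    using assms(1)[of n] by (simp add: hill_def algebra_simps)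
  have up: "v (m + int k) = 0 \<and> v (m + int k - 1) = 0" for k
  proof (induction k)
    case (Suc k)
    thus ?case using r[of "m + int k"] by (simp add: algebra_simps)
  qed (use assms in auto)
  have down: "v (m - int k) = 0 \<and> v (m - int k - 1) = 0" for k
  proof (induction k)
    case (Suc k)
    thus ?case using r[of "m - int k - 1"] by (simp add: algebra_simps)
  qed (use assms in auto)
  show ?thesis
  proof (cases "n \<ge> m")
    case True thus ?thesis using up[of "nat (n - m)"] by simp
  next
    case False thus ?thesis using down[of "nat (m - n)"] by simp
  qed
qed

text \<open>A finitely supported approximate eigenvector living on an occurrence of a factor of \<open>q\<close>
  is wrapped around a circle carrying \<open>q @ q\<close>.\<close>

lemma periodic_approximant:
  fixes v d0 :: "int \<Rightarrow> real"
  assumes \<epsilon>: "\<epsilon> > 0" and q: "length q \<ge> 2" "i + m \<le> length q"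
    and supp: "\<And>n. n \<notin> {s+1..s+int m} \<Longrightarrow> v n = 0"
    and match: "\<And>k. k < m \<Longrightarrow> d0 (s + 1 + int k) = lam * of_bool (q ! (i + k))"
    and approx: "(\<Sum>n\<in>{s..s+int m+1}. (hill d0 e v n)\<^sup>2) < \<epsilon>\<^sup>2 * (\<Sum>n\<in>{s..s+int m+1}. (v n)\<^sup>2)"
  obtains e' where "\<bar>e' - e\<bar> < \<epsilon>" "\<bar>trace (rmat lam e' q)\<bar> \<le> 2" "\<bar>e'\<bar> \<le> 2 + \<bar>lam\<bar>"
proof -
  define L where "L = int (length q)"
  \<comment> \<open>Two copies of q leave room for the m + 2 sites of the window, since q has length
    at least m and at least 2.\<close>
  define l where "l = 2 * L"
  have L: "L \<ge> 2" using q by (simp add: L_def)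
  have l: "l > 0" "l \<ge> int m + 2" using q by (auto simp: L_def l_def)
  \<comment> \<open>Site 1 of the circle stands for site s + 1 and carries letter i of q, where the
    factor occurs.\<close>
  define d where "d = (\<lambda>n. lam * of_bool (q ! nat ((n - 1 + int i) mod L)))"
  have dL: "d (n + L) = d n" for n
  proof -
    have "n + L - 1 + int i = (n - 1 + int i) + L" by simp
    thus ?thesis unfolding d_def by (metis mod_add_self2)
  qed
  have dp: "periodic l d" unfolding periodic_def l_def
    using dL by (metis add.assoc mult_2)
  have dmatch: "d (1 + int k) = d0 (s + 1 + int k)" if "k < m" for k
  proof -
    have "(1 + int k - 1 + int i) mod L = int (i + k)"
      using that q L by (subst mod_pos_pos_trivial) (auto simp: L_def)
    thus ?thesis using match[OF that] by (simp only: d_def nat_int)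
  qed
  define w where "w = (\<lambda>n. v (s + n mod l))"
  have w: "periodic l w" by (simp add: periodic_def w_def)
  \<comment> \<open>The agreement extends one site beyond both ends: v vanishes there and on both
    sides of the seam. The difference operator on the circle thus sees v itself.\<close>
  have wv: "w n = v (s + n)" if "-1 \<le> n" "n \<le> l" for n
  proof -
    have "n = -1 \<or> n = l \<or> 0 \<le> n \<and> n < l" using that by linarith
    thus ?thesis
    proof (elim disjE)
      assume 1: "n = -1"
      have "(-1) mod l = l - 1" using l(1) by (simp add: zmod_minus1)
      thus ?thesis using 1 l by (simp add: w_def supp)
    qed (use l in \<open>auto simp: w_def supp\<close>)
  qed
  have hw: "hill d e w n = hill d0 e v (s + n)" if "n \<in> {0..<l}" for n
  proof -
    have "d n * v (s + n) = d0 (s + n) * v (s + n)"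
    proof (cases "1 \<le> n \<and> n \<le> int m")
      case True
      then obtain k where "n = 1 + int k" "k < m"
        by (intro that[of "nat (n - 1)"]) auto
      thus ?thesis using dmatch[of k] by (simp add: add.assoc)
    next
      case False
      thus ?thesis using supp[of "s + n"] by auto
    qed
    thus ?thesis using that wv[of n] wv[of "n + 1"] wv[of "n - 1"] by (simp add: hill_def add.assoc add_diff_eq)
  qed
  have v0: "hill d0 e v n = 0" "v n = 0" if "n \<notin> {s..s+int m+1}" for n
  proof -
    have "v (n + 1) = 0" "v (n - 1) = 0" "v n = 0" using that by (auto intro!: supp)
    thus "hill d0 e v n = 0" "v n = 0" by (simp_all add: hill_def)
  qed
  have sums: "(\<Sum>n\<in>{0..<l}. (f (s + n))\<^sup>2) = (\<Sum>n\<in>{s..s+int m+1}. (f n)\<^sup>2)"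
    if "\<And>n. n \<notin> {s..s+int m+1} \<Longrightarrow> f n = 0" for f :: "int \<Rightarrow> real"
  proof -
    have "(\<Sum>n\<in>{0..<l}. (f (s + n))\<^sup>2) = (\<Sum>n\<in>{s..<s+l}. (f n)\<^sup>2)"
      by (rule sum.reindex_bij_witness[of _ "\<lambda>n. n - s" "\<lambda>n. s + n"]) auto
    also have "\<dots> = (\<Sum>n\<in>{s..s+int m+1}. (f n)\<^sup>2)"
      using l(2) that by (intro sum.mono_neutral_right) auto
    finally show ?thesis .
  qed
  have "dot l (hill d e w) (hill d e w) = (\<Sum>n\<in>{0..<l}. (hill d0 e v (s + n))\<^sup>2)"
    unfolding dot_def by (intro sum.cong) (auto simp: hw power2_eq_square)
  also have "\<dots> = (\<Sum>n\<in>{s..s+int m+1}. (hill d0 e v n)\<^sup>2)" by (rule sums[OF v0(1)])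
  also have "\<dots> < \<epsilon>\<^sup>2 * (\<Sum>n\<in>{s..s+int m+1}. (v n)\<^sup>2)" by (rule approx)
  also have "(\<Sum>n\<in>{s..s+int m+1}. (v n)\<^sup>2) = (\<Sum>n\<in>{0..<l}. (v (s + n))\<^sup>2)" by (rule sums[OF v0(2), symmetric])
  also have "\<dots> = dot l w w"
    unfolding dot_def by (intro sum.cong) (auto simp: wv power2_eq_square)
  finally obtain e' u n where e': "\<bar>e' - e\<bar> < \<epsilon>" "periodic l u" "u n \<noteq> 0" "\<And>n. hill d e' u n = 0"
    using hill_eigenfunction[OF l(1) dp w \<epsilon>] by blast
  have "\<bar>e'\<bar> \<le> 2 + \<bar>lam\<bar>"
    by (rule eigenvalue_bound[OF l(1) e'(2-4)]) (simp add: d_def abs_mult)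
  moreover have "\<bar>trace (rmat lam e' q)\<bar> \<le> 2"
  proof -
    \<comment> \<open>The site at which a copy of q begins.\<close>
    define n0 where "n0 = 1 - int i"
    have dq: "d (n0 + int k) = lam * of_bool ((q @ q) ! k)" if "k < length (q @ q)" for k
    proof -
      have "nat ((n0 + int k - 1 + int i) mod L) = k mod length q"
        by (simp add: n0_def L_def flip: of_nat_mod)
      moreover have "(q @ q) ! k = q ! (k mod length q)"
        using that by (auto simp: nth_append le_mod_geq)
      ultimately show ?thesis by (simp add: d_def)
    qed
    let ?x = "vector [u n0, u (n0 - 1)] :: real^2"
    have "rmat lam e' (q @ q) *v ?x = vector [u (n0 + l), u (n0 + l - 1)]"
      using rmat_propagates[OF e'(4) dq] by (simp add: l_def L_def)
    also have "\<dots> = ?x" using e'(2) unfolding periodic_def by (metis add_diff_eq add.commute diff_add_eq)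
    finally have fixed: "rmat lam e' (q @ q) *v ?x = ?x" .
    have "?x \<noteq> 0"
    proof
      assume "?x = 0"
      hence "u n0 = 0" "u (n0 - 1) = 0" by (auto simp: vec_eq_iff forall_2 vector_2)
      thus False using hill_zero[OF e'(4)] e'(3) by blast
    qed
    hence "trace (rmat lam e' (q @ q)) = 2" using fixed_vector_trace[OF det_rmat fixed] by blast
    \<comment> \<open>The circle carries q twice, so the fixed vector belongs to the square of the
      matrix of q, whose trace is the squared trace minus 2.\<close>
    hence "(trace (rmat lam e' q))\<^sup>2 = 2\<^sup>2" by (simp add: rmat_append trace_square[OF det_rmat])
    thus ?thesis using abs_le_square_iff[of "trace (rmat lam e' q)" 2] by simp
  qed
  ultimately show ?thesis using that e'(1) by blast
qed

section \<open>Transfer matrices of Sturmian blocks\<close>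

text \<open>Rotation by \<alpha> on [0, 1) exchanges [0, 1 - \<alpha>) and [1 - \<alpha>,
  1).\<close>

lemma coding_sturm:
  assumes "0 < \<alpha>" "\<alpha> < 1" "k < m"
  shows "sturm_pot \<alpha> \<theta> (n + int k) = of_bool (coding (1 - \<alpha>) \<alpha> (frac (of_int n * \<alpha> + \<theta>)) m ! k)"
  using assms(3)
proof (induction m arbitrary: n k)
  case (Suc m)
  let ?p = "frac (of_int n * \<alpha> + \<theta>)"
  have p: "0 \<le> ?p" "?p < 1" by (auto simp: frac_lt_1)
  have next_p: "(if ?p < 1 - \<alpha> then ?p + \<alpha> else ?p - (1 - \<alpha>)) = frac (of_int (n + 1) * \<alpha> + \<theta>)"
  proof (subst eq_commute, subst frac_unique_iff, intro conjI)
    have "of_int (n + 1) * \<alpha> + \<theta> = (of_int n * \<alpha> + \<theta>) + \<alpha>" by (simp add: algebra_simps)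
    also have "\<dots> = of_int \<lfloor>of_int n * \<alpha> + \<theta>\<rfloor> + ?p + \<alpha>" by (simp add: frac_def)
    finally have "of_int (n + 1) * \<alpha> + \<theta> - (if ?p < 1 - \<alpha> then ?p + \<alpha> else ?p - (1 - \<alpha>))
        = of_int (if ?p < 1 - \<alpha> then \<lfloor>of_int n * \<alpha> + \<theta>\<rfloor> else \<lfloor>of_int n * \<alpha> + \<theta>\<rfloor> + 1)" by simp
    thus "of_int (n + 1) * \<alpha> + \<theta> - (if ?p < 1 - \<alpha> then ?p + \<alpha> else ?p - (1 - \<alpha>)) \<in> \<int>"
      by (metis Ints_of_int)
  qed (use p assms(1,2) in auto)
  show ?case
  proof (cases k)
    case 0
    thus ?thesis using p by (auto simp: sturm_pot_def)
  next
    case (Suc j)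
    have "sturm_pot \<alpha> \<theta> (n + 1 + int j) = of_bool (coding (1 - \<alpha>) \<alpha> (frac (of_int (n + 1) * \<alpha> + \<theta>)) m ! j)"
      using Suc.IH[of j "n + 1"] Suc Suc.prems by simp
    moreover have "n + int k = n + 1 + int j" using Suc by simp
    ultimately show ?thesis by (simp only: Suc coding.simps nth_Cons_Suc next_p)
  qed
qed simp

lemma length_coding [simp]: "length (coding x y p n) = n"
  by (induction n arbitrary: p) auto

lemma sturm_word_coding:
  assumes "0 < \<alpha>" "\<alpha> < 1"
  shows "sturm_word \<alpha> \<theta> n = map of_bool (coding (1 - \<alpha>) \<alpha> (frac (\<alpha> + \<theta>)) n)"
proof (rule nth_equalityI)
  fix k assume "k < length (sturm_word \<alpha> \<theta> n)"
  hence k: "k < n" by (simp add: sturm_word_def del: upt_Suc)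
  thus "sturm_word \<alpha> \<theta> n ! k = map of_bool (coding (1 - \<alpha>) \<alpha> (frac (\<alpha> + \<theta>)) n) ! k"
    using coding_sturm[OF assms k, of \<theta> 1] by (simp add: sturm_word_def del: upt_Suc)
qed (simp add: sturm_word_def del: upt_Suc)

lemma transfer_word_append_foldl:
  "foldl (\<lambda>M a. transfer lam E a ** M) (M :: complex^2^2) w = transfer_word lam E w ** M"
proof (induction w arbitrary: M)
  case (Cons a w)
  show ?case
    unfolding transfer_word_def foldl_Cons Cons[of "transfer lam E a ** M"] Cons[of "transfer lam E a ** mat 1"]
    by (simp add: matrix_mul_assoc)
qed (simp add: transfer_word_def)

lemma transfer_word_Cons: "transfer_word lam E (a # w) = transfer_word lam E w ** transfer lam E a"
  using transfer_word_append_foldl[of lam E "transfer lam E a ** mat 1" w]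
  by (simp add: transfer_word_def)

lemma transfer_word_real:
  "transfer_word lam (of_real e) (map of_bool w) $ i $ j = of_real (rmat lam e w $ i $ j)"
proof (induction w arbitrary: i j)
  case Nil
  thus ?case by (simp add: transfer_word_def mat_def)
next
  case (Cons b w)
  have "transfer lam (of_real e) (of_bool b) $ i $ j = of_real (rstep lam e b $ i $ j)" for i j :: 2
    using exhaust_2[of i] exhaust_2[of j] by (auto simp: transfer_def rstep_def vector_2)
  thus ?case using Cons by (simp add: transfer_word_Cons mult_2_nth)
qed

lemma mat_opnorm_real:
  assumes "\<And>i j. A $ i $ j = complex_of_real (M $ i $ j)"
  shows "mat_opnorm A \<le> nrm2 M"
  unfolding mat_opnorm_def
proof (rule onorm_le)
  fix x :: "complex^2"
  have c: "cmod (x $ j) \<le> norm x" for j by (rule Finite_Cartesian_Product.norm_nth_le)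
  have row: "cmod ((A *v x) $ i) \<le> \<bar>M$i$1\<bar> * norm x + \<bar>M$i$2\<bar> * norm x" for i
  proof -
    have "(A *v x) $ i = of_real (M$i$1) * x$1 + of_real (M$i$2) * x$2"
      by (simp add: matrix_vector_mult_def sum_2 assms)
    hence "cmod ((A *v x) $ i) \<le> \<bar>M$i$1\<bar> * cmod (x$1) + \<bar>M$i$2\<bar> * cmod (x$2)"
      by (metis norm_triangle_ineq norm_mult norm_of_real)
    also have "\<dots> \<le> \<bar>M$i$1\<bar> * norm x + \<bar>M$i$2\<bar> * norm x"
      by (intro add_mono mult_left_mono c) auto
    finally show ?thesis .
  qed
  have "norm (A *v x) \<le> cmod ((A *v x) $ 1) + cmod ((A *v x) $ 2)"
    using L2_set_le_sum[of UNIV "\<lambda>i. cmod ((A *v x) $ i)"] by (simp add: norm_vec_def sum_2)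
  also have "\<dots> \<le> (\<bar>M$1$1\<bar> * norm x + \<bar>M$1$2\<bar> * norm x) + (\<bar>M$2$1\<bar> * norm x + \<bar>M$2$2\<bar> * norm x)"
    by (intro add_mono row)
  also have "\<dots> = nrm2 M * norm x" by (simp add: nrm2_def algebra_simps)
  finally show "norm (A *v x) \<le> nrm2 M * norm x" .
qed

text \<open>The longer interval wins: its block is kept and is put in front of the other
  one.\<close>

definition left_wins :: "real \<Rightarrow> nat \<Rightarrow> bool" where
  "left_wins \<alpha> t = (case euclid \<alpha> t of (x, y, U, V) \<Rightarrow> y < x)"

definition left_block :: "real \<Rightarrow> nat \<Rightarrow> bool list" where
  "left_block \<alpha> t = (case euclid \<alpha> t of (x, y, U, V) \<Rightarrow> U)"

definition right_block :: "real \<Rightarrow> nat \<Rightarrow> bool list" where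
  "right_block \<alpha> t = (case euclid \<alpha> t of (x, y, U, V) \<Rightarrow> V)"

lemma block_0: "left_block \<alpha> 0 = [False]" "right_block \<alpha> 0 = [True]"
  by (simp_all add: left_block_def right_block_def euclid_0)

lemma block_Suc:
  "left_block \<alpha> (Suc t) = (if left_wins \<alpha> t then left_block \<alpha> t else right_block \<alpha> t @ left_block \<alpha> t)"
  "right_block \<alpha> (Suc t) = (if left_wins \<alpha> t then left_block \<alpha> t @ right_block \<alpha> t else right_block \<alpha> t)"
  by (cases "euclid \<alpha> t"; simp add: left_block_def right_block_def left_wins_def euclid_Suc)+

lemma block_length_mono:
  assumes "s \<le> t"
  shows "length (left_block \<alpha> s) \<le> length (left_block \<alpha> t) \<and> length (right_block \<alpha> s) \<le> length (right_block \<alpha> t)"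
  using assms
proof (induction t rule: dec_induct)
  case (step t)
  thus ?case by (auto simp: block_Suc)
qed simp

lemma block_nonempty: "left_block \<alpha> t \<noteq> []" "right_block \<alpha> t \<noteq> []"
  by (induction t) (auto simp: block_0 block_Suc)

lemma factor_in_two_blocks:
  assumes "0 < \<alpha>" "\<alpha> < 1" "\<alpha> \<notin> \<rat>" "0 \<le> p" "p < 1"
    "n \<le> length (left_block \<alpha> t)" "n \<le> length (right_block \<alpha> t)"
  obtains X Y where "X \<in> {left_block \<alpha> t, right_block \<alpha> t}" "Y \<in> {left_block \<alpha> t, right_block \<alpha> t}"
    "sublist (coding (1 - \<alpha>) \<alpha> p n) (X @ Y)"
proof -
  obtain x y U V where s: "euclid \<alpha> t = (x, y, U, V)" by (metis prod_cases4)
  have UV: "left_block \<alpha> t = U" "right_block \<alpha> t = V" by (simp_all add: left_block_def right_block_def s)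
  obtain p' m where "sublist (coding (1 - \<alpha>) \<alpha> p n) (blocks U V (coding x y p' m))"
    using coding_in_blocks[OF assms(1-5) s] by blast
  from sublist_two_blocks[OF this] show ?thesis using that assms(6,7) by (auto simp: UV)
qed

text \<open>A finitely supported approximate eigenvector sees a factor of finite length, which lies
  in two blocks of any sufficiently late step. Wrapping it around their concatenation yields a
  nearby periodic eigenvalue. The step may be taken beyond any t0, which lets a persistent condition
  be tested.\<close>

lemma spectrum_approximant:
  assumes \<alpha>: "0 < \<alpha>" "\<alpha> < 1" "\<alpha> \<notin> \<rat>" "bounded_density \<alpha>"
    and E: "of_real e \<in> sturm_spectrum lam \<alpha>" and \<epsilon>: "\<epsilon> > 0"
  obtains t X Y e' where "t \<ge> t0" "X \<in> {left_block \<alpha> t, right_block \<alpha> t}" "Y \<in> {left_block \<alpha> t, right_block \<alpha> t}"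
    "\<bar>e' - e\<bar> < \<epsilon>" "\<bar>trace (rmat lam e' (X @ Y))\<bar> \<le> 2" "\<bar>e'\<bar> \<le> 2 + \<bar>lam\<bar>"
proof -
  obtain \<theta> where E: "of_real e \<in> op_spectrum (sturm_op lam \<alpha> \<theta>)"
    using E by (auto simp: sturm_spectrum_def)
  define d where "d = (\<lambda>n. lam * sturm_pot \<alpha> \<theta> n)"
  have op: "sturm_op lam \<alpha> \<theta> = jacobi d" by (auto simp: sturm_op_def jacobi_def d_def fun_eq_iff)
  have d: "\<forall>n. \<bar>d n\<bar> \<le> \<bar>lam\<bar>" by (simp add: d_def sturm_pot_def)
  have \<epsilon>2: "\<epsilon>\<^sup>2 > 0" using \<epsilon> by simp
  obtain v s m where v: "\<And>n. n \<notin> {s+1..s+int m} \<Longrightarrow> v n = 0"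
    "(\<Sum>n\<in>{s..s+int m+1}. (v (n+1) + v (n-1) + d n * v n - e * v n)\<^sup>2) < \<epsilon>\<^sup>2 * (\<Sum>n\<in>{s..s+int m+1}. (v n)\<^sup>2)"
    by (rule weyl_vector_real[OF d E[unfolded op] \<epsilon>2]) (assumption | rule that)+
  obtain K where K: "\<And>m. \<exists>t \<le> K * (2 * m + 1). \<exists>x y U V. euclid \<alpha> t = (x, y, U, V) \<and> 2 ^ m \<le> length U \<and> 2 ^ m \<le> length V"
    using block_growth[OF \<alpha>] by blast
  obtain t1 x y U V where s1: "euclid \<alpha> t1 = (x, y, U, V)" "2 ^ m \<le> length U" "2 ^ m \<le> length V"
    using K[of m] by blast
  hence t1: "2 ^ m \<le> length (left_block \<alpha> t1)" "2 ^ m \<le> length (right_block \<alpha> t1)"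
    by (simp_all add: left_block_def right_block_def)
  define t where "t = max t0 t1"
  have "m < 2 ^ m" by (rule less_exp)
  moreover have "2 ^ m \<le> length (left_block \<alpha> t)" "2 ^ m \<le> length (right_block \<alpha> t)"
    using t1 block_length_mono[of t1 t \<alpha>] by (auto simp: t_def)
  ultimately have len: "m \<le> length (left_block \<alpha> t)" "m \<le> length (right_block \<alpha> t)" by linarith+
  let ?p = "frac (of_int (s + 1) * \<alpha> + \<theta>)"
  obtain X Y where XY: "X \<in> {left_block \<alpha> t, right_block \<alpha> t}" "Y \<in> {left_block \<alpha> t, right_block \<alpha> t}"
    "sublist (coding (1 - \<alpha>) \<alpha> ?p m) (X @ Y)"
    by (rule factor_in_two_blocks[OF \<alpha>(1-3) frac_ge_0 frac_lt_1 len]) (assumption | rule that)+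
  from XY(3) obtain ps ss where ps: "X @ Y = ps @ coding (1 - \<alpha>) \<alpha> ?p m @ ss" by (auto simp: sublist_def)
  have "X \<noteq> []" using XY(1) block_nonempty[of \<alpha> t] by (elim insertE emptyE) simp_all
  moreover have "Y \<noteq> []" using XY(2) block_nonempty[of \<alpha> t] by (elim insertE emptyE) simp_all
  ultimately have q: "length (X @ Y) \<ge> 2" by (cases X; cases Y) auto
  have im: "length ps + m \<le> length (X @ Y)" unfolding ps by simp
  have match: "d (s + 1 + int k) = lam * of_bool ((X @ Y) ! (length ps + k))" if "k < m" for k
    using coding_sturm[OF \<alpha>(1,2) that, of \<theta> "s + 1"] that unfolding ps by (simp add: d_def nth_append)
  obtain e' where "\<bar>e' - e\<bar> < \<epsilon>" "\<bar>trace (rmat lam e' (X @ Y))\<bar> \<le> 2" "\<bar>e'\<bar> \<le> 2 + \<bar>lam\<bar>"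
  proof (rule periodic_approximant[OF \<epsilon> q im])
    show "v n = 0" if "n \<notin> {s+1..s+int m}" for n by (rule v(1)[OF that])
    show "d (s + 1 + int k) = lam * of_bool ((X @ Y) ! (length ps + k))" if "k < m" for k
      by (rule match[OF that])
    show "(\<Sum>n\<in>{s..s+int m+1}. (hill d e v n)\<^sup>2) < \<epsilon>\<^sup>2 * (\<Sum>n\<in>{s..s+int m+1}. (v n)\<^sup>2)"
      unfolding hill_def by (rule v(2))
  qed (rule that)
  thus ?thesis using that[of t X Y e'] XY(1,2) by (simp add: t_def)
qed

lemma sturm_spectrum_real:
  assumes "E \<in> sturm_spectrum lam \<alpha>" shows "E = of_real (Re E)"
proof -
  obtain \<theta> where E: "E \<in> op_spectrum (sturm_op lam \<alpha> \<theta>)"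
    using assms by (auto simp: sturm_spectrum_def)
  have op: "sturm_op lam \<alpha> \<theta> = jacobi (\<lambda>n. lam * sturm_pot \<alpha> \<theta> n)" by (auto simp: sturm_op_def jacobi_def fun_eq_iff)
  have "Im E = 0" by (rule spectrum_real[of _ "\<bar>lam\<bar>", OF _ E[unfolded op]]) (simp add: sturm_pot_def)
  thus ?thesis by (simp add: complex_eq_iff)
qed

section \<open>Block traces at energies in the spectrum\<close>

definition left_mat :: "real \<Rightarrow> real \<Rightarrow> real \<Rightarrow> nat \<Rightarrow> real^2^2" where
  "left_mat \<alpha> lam e t = rmat lam e (left_block \<alpha> t)"

definition right_mat :: "real \<Rightarrow> real \<Rightarrow> real \<Rightarrow> nat \<Rightarrow> real^2^2" where
  "right_mat \<alpha> lam e t = rmat lam e (right_block \<alpha> t)"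

definition escapes :: "real \<Rightarrow> real \<Rightarrow> nat \<Rightarrow> real \<Rightarrow> bool" where
  "escapes \<alpha> lam t e = escaping (trace (left_mat \<alpha> lam e t)) (trace (right_mat \<alpha> lam e t)) (trace (left_mat \<alpha> lam e t ** right_mat \<alpha> lam e t))"

lemma det_block: "det (left_mat \<alpha> lam e t) = 1" "det (right_mat \<alpha> lam e t) = 1"
  by (simp_all add: left_mat_def right_mat_def det_rmat)

lemma block_mat_Suc:
  "left_mat \<alpha> lam e (Suc t) = (if left_wins \<alpha> t then left_mat \<alpha> lam e t else left_mat \<alpha> lam e t ** right_mat \<alpha> lam e t)"
  "right_mat \<alpha> lam e (Suc t) = (if left_wins \<alpha> t then right_mat \<alpha> lam e t ** left_mat \<alpha> lam e t else right_mat \<alpha> lam e t)"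
  by (simp_all add: left_mat_def right_mat_def block_Suc rmat_append)

lemma escapes_Suc: "escapes \<alpha> lam t e \<Longrightarrow> escapes \<alpha> lam (Suc t) e"
proof (cases "left_wins \<alpha> t")
  case True
  assume "escapes \<alpha> lam t e"
  from escaping_step[OF this[unfolded escapes_def]] show ?thesis
    using True by (simp add: escapes_def block_mat_Suc trace_step[OF det_block(1)] trace_mul_sym[of "right_mat \<alpha> lam e t"])
next
  case False
  let ?A = "left_mat \<alpha> lam e t" and ?B = "right_mat \<alpha> lam e t"
  assume "escapes \<alpha> lam t e"
  hence "escaping (trace ?B) (trace ?A) (trace (?A ** ?B))" by (simp add: escapes_def escaping_swap)
  from escaping_step[OF this]
  have "escaping (trace (?A ** ?B)) (trace ?B) (trace ?B * trace (?A ** ?B) - trace ?A)"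
    by (simp add: escaping_swap)
  moreover have "trace (?A ** ?B ** ?B) = trace ?B * trace (?A ** ?B) - trace ?A"
    using trace_step[OF det_block(2), of \<alpha> lam e t ?A]
    by (simp add: trace_mul_sym[of ?B])
  ultimately show ?thesis using False by (simp add: escapes_def block_mat_Suc)
qed

lemma escapes_mono: "t0 \<le> t \<Longrightarrow> escapes \<alpha> lam t0 e \<Longrightarrow> escapes \<alpha> lam t e"
  by (induction t rule: dec_induct) (auto intro: escapes_Suc)

lemma continuous_rmat: "continuous_on UNIV (\<lambda>e. rmat lam e w $ i $ j)"
proof (induction w arbitrary: i j)
  case Nil
  show ?case by simp
next
  case (Cons b w)
  have "continuous_on UNIV (\<lambda>e. rstep lam e b $ i $ j)" for i j :: 2
    using exhaust_2[of i] exhaust_2[of j]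
    by (elim disjE) (simp_all add: rstep_def vector_2 continuous_on_diff)
  thus ?case using Cons by (simp add: mult_2_nth continuous_on_add continuous_on_mult)
qed

lemma open_escapes: "open {e. escapes \<alpha> lam t e}"
  unfolding escapes_def escaping_def trace_2 mult_2_nth left_mat_def right_mat_def
  by (intro open_Collect_conj open_Collect_less continuous_on_const continuous_on_rabs
      continuous_on_add continuous_on_mult continuous_rmat)

text \<open>An escape would persist to the late step and the nearby energy of
  \<open>spectrum_approximant\<close>. There the concatenation of two blocks has the trace of AB, of
  A^2 or of B^2, and each of these exceeds 2 in absolute value.\<close>

lemma spectrum_no_escape:
  assumes \<alpha>: "0 < \<alpha>" "\<alpha> < 1" "\<alpha> \<notin> \<rat>" "bounded_density \<alpha>"
    and E: "of_real e \<in> sturm_spectrum lam \<alpha>"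
  shows "\<not> escapes \<alpha> lam t0 e" "\<bar>e\<bar> \<le> 3 + \<bar>lam\<bar>"
proof -
  \<comment> \<open>Some periodic eigenvalue, bounded by 2 + |lam|, lies within distance 1.\<close>
  show "\<bar>e\<bar> \<le> 3 + \<bar>lam\<bar>"
    by (rule spectrum_approximant[OF \<alpha> E zero_less_one, of 0]) linarith
  show "\<not> escapes \<alpha> lam t0 e"
  proof
    assume "escapes \<alpha> lam t0 e"
    then obtain \<epsilon> where \<epsilon>: "\<epsilon> > 0" "\<And>e'. \<bar>e' - e\<bar> < \<epsilon> \<Longrightarrow> escapes \<alpha> lam t0 e'"
      using open_escapes[of \<alpha> lam t0] unfolding open_dist by (auto simp: dist_real_def)
    obtain t X Y e' where *: "t \<ge> t0" "X \<in> {left_block \<alpha> t, right_block \<alpha> t}" "Y \<in> {left_block \<alpha> t, right_block \<alpha> t}"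
      "\<bar>e' - e\<bar> < \<epsilon>" "\<bar>trace (rmat lam e' (X @ Y))\<bar> \<le> 2"
      by (rule spectrum_approximant[OF \<alpha> E \<epsilon>(1), of t0]) (assumption | rule that)+
    let ?A = "left_mat \<alpha> lam e' t" and ?B = "right_mat \<alpha> lam e' t"
    have "escapes \<alpha> lam t e'" using escapes_mono[OF *(1)] \<epsilon>(2) *(4) by blast
    hence esc: "\<bar>trace ?A\<bar> > 2" "\<bar>trace ?B\<bar> > 2" "\<bar>trace (?A ** ?B)\<bar> > 2"
      by (auto simp: escapes_def escaping_def)
    have square: "\<bar>trace (M ** M)\<bar> > 2" if "det M = 1" "\<bar>trace M\<bar> > 2" for M :: "real^2^2"
    proof -
      have "2\<^sup>2 < \<bar>trace M\<bar>\<^sup>2" using that(2) by (intro power_strict_mono) auto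
      thus ?thesis using trace_square[OF that(1)] by simp
    qed
    have "\<bar>trace (rmat lam e' (X @ Y))\<bar> > 2"
      using *(2,3) esc square[OF det_block(1) esc(1)] square[OF det_block(2) esc(2)]
      by (auto simp: rmat_append left_mat_def right_mat_def trace_mul_sym[of "rmat lam e' (right_block \<alpha> t)" "rmat lam e' (left_block \<alpha> t)"])
    thus False using *(5) by simp
  qed
qed

lemma fricke_block:
  "fricke (trace (left_mat \<alpha> lam e t)) (trace (right_mat \<alpha> lam e t)) (trace (left_mat \<alpha> lam e t ** right_mat \<alpha> lam e t)) = 4 + lam\<^sup>2"
proof (induction t)
  case 0
  show ?case
    by (simp add: left_mat_def right_mat_def block_0 rstep_def trace_2 mult_2_nth vector_2 fricke_def
        power2_eq_square algebra_simps)
next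
  case (Suc t)
  let ?A = "left_mat \<alpha> lam e t" and ?B = "right_mat \<alpha> lam e t"
  show ?case
  proof (cases "left_wins \<alpha> t")
    case True
    thus ?thesis using Suc
      by (simp add: block_mat_Suc trace_step[OF det_block(1)] trace_mul_sym[of ?B] fricke_step)
  next
    case False
    have "trace (?A ** ?B ** ?B) = trace ?B * trace (?A ** ?B) - trace ?A"
      using trace_step[OF det_block(2), of \<alpha> lam e t ?A] by (simp add: trace_mul_sym[of ?B])
    moreover have "fricke z y (y * z - x) = fricke x y z" for x y z
      using fricke_step[of y z x] by (simp only: fricke_swap[of z y] fricke_swap[of y x])
    ultimately show ?thesis using False Suc by (simp add: block_mat_Suc)
  qed
qed

definition winner_mat :: "real \<Rightarrow> real \<Rightarrow> real \<Rightarrow> nat \<Rightarrow> real^2^2" where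
  "winner_mat \<alpha> lam e t = (if left_wins \<alpha> t then left_mat \<alpha> lam e t else right_mat \<alpha> lam e t)"

definition loser_mat :: "real \<Rightarrow> real \<Rightarrow> real \<Rightarrow> nat \<Rightarrow> real^2^2" where
  "loser_mat \<alpha> lam e t = (if left_wins \<alpha> t then right_mat \<alpha> lam e t else left_mat \<alpha> lam e t)"

lemma det_winner: "det (winner_mat \<alpha> lam e t) = 1" "det (loser_mat \<alpha> lam e t) = 1"
  by (simp_all add: winner_mat_def loser_mat_def det_block)

text \<open>The block created by a step begins with the winning block, so its matrix is
  \<open>L ** W\<close> whichever side wins. It either wins the next step or becomes the new
  loser.\<close>

lemma winner_Suc:
  "(winner_mat \<alpha> lam e (Suc t) = winner_mat \<alpha> lam e t \<and> loser_mat \<alpha> lam e (Suc t) = loser_mat \<alpha> lam e t ** winner_mat \<alpha> lam e t) \<or>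
   (winner_mat \<alpha> lam e (Suc t) = loser_mat \<alpha> lam e t ** winner_mat \<alpha> lam e t \<and> loser_mat \<alpha> lam e (Suc t) = winner_mat \<alpha> lam e t)"
  by (simp add: winner_mat_def loser_mat_def block_mat_Suc)

lemma fricke_winner:
  "fricke (trace (winner_mat \<alpha> lam e t)) (trace (loser_mat \<alpha> lam e t)) (trace (loser_mat \<alpha> lam e t ** winner_mat \<alpha> lam e t)) = 4 + lam\<^sup>2"
  using fricke_block[of \<alpha> lam e t]
  by (simp add: winner_mat_def loser_mat_def trace_mul_sym[of "right_mat \<alpha> lam e t"] fricke_swap[of "trace (right_mat \<alpha> lam e t)"])

lemma trace_winner_step:
  "trace (winner_mat \<alpha> lam e t ** (loser_mat \<alpha> lam e t ** winner_mat \<alpha> lam e t))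
     = trace (winner_mat \<alpha> lam e t) * trace (loser_mat \<alpha> lam e t ** winner_mat \<alpha> lam e t) - trace (loser_mat \<alpha> lam e t)"
  using trace_step[OF det_winner(1), of \<alpha> lam e t "loser_mat \<alpha> lam e t"]
  unfolding trace_mul_sym[of "winner_mat \<alpha> lam e t" "loser_mat \<alpha> lam e t"] .

lemma escapes_winner:
  "escapes \<alpha> lam t e = escaping (trace (winner_mat \<alpha> lam e t)) (trace (loser_mat \<alpha> lam e t)) (trace (loser_mat \<alpha> lam e t ** winner_mat \<alpha> lam e t))"
  by (simp add: escapes_def winner_mat_def loser_mat_def trace_mul_sym[of "right_mat \<alpha> lam e t"] escaping_swap[of "trace (right_mat \<alpha> lam e t)"])

lemma nrm2_rstep: "nrm2 (rstep lam e b) \<le> \<bar>e\<bar> + \<bar>lam\<bar> + 2"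
  by (cases b) (auto simp: nrm2_def rstep_def vector_2)

lemma winner_trace_bound:
  assumes "\<And>t. \<not> escapes \<alpha> lam t e" "\<bar>e\<bar> + \<bar>lam\<bar> \<le> R" "3 + lam\<^sup>2 \<le> R"
  shows "\<bar>trace (winner_mat \<alpha> lam e t)\<bar> \<le> 2 * R"
proof (rule bounded_excursions[where X = "\<lambda>t. trace (winner_mat \<alpha> lam e t)" and Y = "\<lambda>t. trace (loser_mat \<alpha> lam e t)"
      and Z = "\<lambda>t. trace (loser_mat \<alpha> lam e t ** winner_mat \<alpha> lam e t)" and I = "lam\<^sup>2"])
  fix t
  show "(trace (winner_mat \<alpha> lam e (Suc t)) = trace (winner_mat \<alpha> lam e t) \<and>
        trace (loser_mat \<alpha> lam e (Suc t)) = trace (loser_mat \<alpha> lam e t ** winner_mat \<alpha> lam e t)) \<or>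
        (trace (winner_mat \<alpha> lam e (Suc t)) = trace (loser_mat \<alpha> lam e t ** winner_mat \<alpha> lam e t) \<and>
        trace (loser_mat \<alpha> lam e (Suc t)) = trace (winner_mat \<alpha> lam e t))"
    using winner_Suc[of \<alpha> lam e t] by auto
  show "trace (loser_mat \<alpha> lam e (Suc t) ** winner_mat \<alpha> lam e (Suc t)) =
      trace (winner_mat \<alpha> lam e t) * trace (loser_mat \<alpha> lam e t ** winner_mat \<alpha> lam e t) - trace (loser_mat \<alpha> lam e t)"
    using winner_Suc[of \<alpha> lam e t] trace_winner_step[of \<alpha> lam e t] trace_mul_sym by metis
  show "\<not> escaping (trace (winner_mat \<alpha> lam e t)) (trace (loser_mat \<alpha> lam e t)) (trace (loser_mat \<alpha> lam e t ** winner_mat \<alpha> lam e t))"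
    using assms(1) by (simp add: escapes_winner)
next
  have "\<bar>trace (rstep lam e b)\<bar> \<le> R" for b
    using assms(2) by (cases b) (auto simp: rstep_def trace_2 vector_2)
  thus "\<bar>trace (winner_mat \<alpha> lam e 0)\<bar> \<le> R" "\<bar>trace (loser_mat \<alpha> lam e 0)\<bar> \<le> R"
    by (simp_all add: winner_mat_def loser_mat_def left_mat_def right_mat_def block_0)
qed (use assms(3) fricke_winner in auto)

section \<open>Norms of prefix products and of arbitrary factors\<close>

definition prefix_mats :: "real \<Rightarrow> real \<Rightarrow> real \<Rightarrow> nat \<Rightarrow> (real^2^2) set" where
  "prefix_mats \<alpha> lam e t = rmat lam e ` {q. prefix q (left_block \<alpha> t) \<or> prefix q (right_block \<alpha> t)}"

text \<open>A prefix of the new block is a prefix of the winning block, or that block followed by a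
  prefix of the other one.\<close>

lemma prefix_mats_Suc:
  "prefix_mats \<alpha> lam e (Suc t) \<subseteq> prefix_mats \<alpha> lam e t \<union> (\<lambda>Q. Q ** winner_mat \<alpha> lam e t) ` prefix_mats \<alpha> lam e t"
proof -
  have "rmat lam e q \<in> prefix_mats \<alpha> lam e t \<union> (\<lambda>Q. Q ** rmat lam e U) ` prefix_mats \<alpha> lam e t"
    if q: "prefix q (U @ V)" "U \<in> {left_block \<alpha> t, right_block \<alpha> t}" "V \<in> {left_block \<alpha> t, right_block \<alpha> t}" for q U V
  proof (cases "prefix q U")
    case True
    thus ?thesis using q(2) by (auto simp: prefix_mats_def)
  next
    case False
    then obtain q' where "q = U @ q'" "prefix q' V" using q(1) by (auto simp: prefix_append)
    thus ?thesis using q(3) by (auto simp: prefix_mats_def rmat_append)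
  qed
  note * = this
  show ?thesis
  proof
    fix M assume "M \<in> prefix_mats \<alpha> lam e (Suc t)"
    then obtain q where q: "M = rmat lam e q" "prefix q (left_block \<alpha> (Suc t)) \<or> prefix q (right_block \<alpha> (Suc t))"
      by (auto simp: prefix_mats_def)
    show "M \<in> prefix_mats \<alpha> lam e t \<union> (\<lambda>Q. Q ** winner_mat \<alpha> lam e t) ` prefix_mats \<alpha> lam e t"
    proof (cases "prefix q (left_block \<alpha> t) \<or> prefix q (right_block \<alpha> t)")
      case True
      thus ?thesis using q(1) by (auto simp: prefix_mats_def)
    next
      case False
      show ?thesis
      proof (cases "left_wins \<alpha> t")
        case True
        hence "prefix q (left_block \<alpha> t @ right_block \<alpha> t)" using q(2) False by (auto simp: block_Suc)
        from *[OF this] show ?thesis using True q(1) by (simp add: winner_mat_def left_mat_def)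
      next
        case f: False
        hence "prefix q (right_block \<alpha> t @ left_block \<alpha> t)" using q(2) False by (auto simp: block_Suc)
        from *[OF this] show ?thesis using f q(1) by (simp add: winner_mat_def right_mat_def)
      qed
    qed
  qed
qed

text \<open>A prefix is at most one letter and a basis word at most three, which makes four factors.
  The summand 2 in the bound D also covers the identity, of \<open>nrm2\<close> equal to 2.\<close>

lemma nrm_bound_initial:
  assumes D: "\<bar>e\<bar> + \<bar>lam\<bar> + 2 \<le> D"
  shows "nrm_bound (prefix_mats \<alpha> lam e 0) (word_basis (winner_mat \<alpha> lam e 0) (loser_mat \<alpha> lam e 0)) (D ^ 4)"
proof -
  have D2: "D \<ge> 2" using D by linarith
  define T where "T = {mat 1, rstep lam e False, rstep lam e True}"
  have one: "nrm2 (mat 1) = 2" by (simp add: nrm2_def mat_2_nth)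
  have T: "nrm2 M \<le> D" if "M \<in> T" for M
    using that nrm2_rstep[of lam e True] nrm2_rstep[of lam e False] D one by (auto simp: T_def)
  have prod: "nrm2 (M ** N) \<le> x * y" if "nrm2 M \<le> x" "nrm2 N \<le> y" for M N x y
  proof -
    have "nrm2 (M ** N) \<le> nrm2 M * nrm2 N" by (rule nrm2_mult)
    also have "\<dots> \<le> x * y" using that nrm2_nonneg[of M] nrm2_nonneg[of N] by (intro mult_mono) auto
    finally show ?thesis .
  qed
  have S: "prefix_mats \<alpha> lam e 0 \<subseteq> T"
    by (auto simp: prefix_mats_def block_0 prefix_Cons T_def)
  have W: "winner_mat \<alpha> lam e 0 \<in> T" "loser_mat \<alpha> lam e 0 \<in> T"
    by (auto simp: winner_mat_def loser_mat_def left_mat_def right_mat_def block_0 T_def)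
  have one': "mat 1 \<in> T" by (simp add: T_def)
  have B: "\<exists>M\<in>T. \<exists>N\<in>T. \<exists>P\<in>T. X = M ** N ** P" if "X \<in> word_basis (winner_mat \<alpha> lam e 0) (loser_mat \<alpha> lam e 0)" for X
    using that W one' unfolding word_basis_def by (metis (no_types, lifting) insertE empty_iff matrix_mul_lid matrix_mul_rid)
  show ?thesis
    unfolding nrm_bound_def
  proof (intro ballI)
    fix Q X assume Q: "Q \<in> prefix_mats \<alpha> lam e 0" and X: "X \<in> word_basis (winner_mat \<alpha> lam e 0) (loser_mat \<alpha> lam e 0)"
    obtain M N P where M: "M \<in> T" "N \<in> T" "P \<in> T" "X = M ** N ** P" using B[OF X] by blast
    have "nrm2 (Q ** X) \<le> D * (D * D * D)"
      unfolding M(4) using Q S M(1-3) by (intro prod T) auto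
    thus "nrm2 (Q ** X) \<le> D ^ 4" by (simp add: power4_eq_xxxx mult_ac)
  qed
qed

text \<open>A prefix of two concatenated blocks costs at most G^2. A factor is such a prefix times
  the inverse of another, which gives G^4.\<close>

lemma factor_nrm_bound:
  assumes \<alpha>: "0 < \<alpha>" "\<alpha> < 1" "\<alpha> \<notin> \<rat>"
    and esc: "\<And>t. \<not> escapes \<alpha> lam t e" and R: "\<bar>e\<bar> + \<bar>lam\<bar> \<le> R" "3 + lam\<^sup>2 \<le> R"
    and p: "0 \<le> p" "p < 1"
    and len: "n \<le> length (left_block \<alpha> t)" "n \<le> length (right_block \<alpha> t)"
  shows "nrm2 (rmat lam e (coding (1 - \<alpha>) \<alpha> p n))
      \<le> ((R + 2) ^ 4 * ((1 + 2 * R)\<^sup>2 * (1 + 2 * R + ((2 * R)\<^sup>2 + 4 + lam\<^sup>2))) ^ t) ^ 4"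
proof -
  let ?d = "(2 * R)\<^sup>2 + 4 + lam\<^sup>2"
  let ?C = "(1 + 2 * R)\<^sup>2 * (1 + 2 * R + ?d)"
  define G where "G = (R + 2) ^ 4 * ?C ^ t"
  have R3: "R \<ge> 3" using R(2) zero_le_power2[of lam] by linarith
  have C1: "?C \<ge> 1"
  proof -
    have "1 * 1 \<le> ?C" using R3 by (intro mult_mono) (auto intro: add_increasing2 add_nonneg_nonneg)
    thus ?thesis by simp
  qed
  have G1: "G \<ge> 1"
  proof -
    have "1 * 1 \<le> G" unfolding G_def using R3 C1 by (intro mult_mono one_le_power) auto
    thus ?thesis by simp
  qed
  have tr: "\<bar>trace (winner_mat \<alpha> lam e t)\<bar> \<le> 2 * R" for t by (rule winner_trace_bound[OF esc R])
  \<comment> \<open>At an exchange \<open>L ** W\<close> is the next winner, so its trace is bounded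
    like that of \<open>W\<close>, and the invariant bounds the trace of their product.\<close>
  have d: "\<bar>trace (winner_mat \<alpha> lam e t ** (loser_mat \<alpha> lam e t ** winner_mat \<alpha> lam e t))\<bar> \<le> ?d"
    if "winner_mat \<alpha> lam e (Suc t) = loser_mat \<alpha> lam e t ** winner_mat \<alpha> lam e t" for t
  proof (rule fricke_root_bound)
    show "fricke (trace (winner_mat \<alpha> lam e t)) (trace (loser_mat \<alpha> lam e t ** winner_mat \<alpha> lam e t))
        (trace (winner_mat \<alpha> lam e t ** (loser_mat \<alpha> lam e t ** winner_mat \<alpha> lam e t))) = 4 + lam\<^sup>2"
      unfolding trace_winner_step fricke_step by (rule fricke_winner)
    show "\<bar>trace (loser_mat \<alpha> lam e t ** winner_mat \<alpha> lam e t)\<bar> \<le> 2 * R" using tr[of "Suc t"] that by simp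
  qed (use tr in auto)
  have bound: "nrm_bound (prefix_mats \<alpha> lam e t) (word_basis (winner_mat \<alpha> lam e t) (loser_mat \<alpha> lam e t)) G"
    unfolding G_def
  proof (rule nrm_growth[where W = "winner_mat \<alpha> lam e" and L = "loser_mat \<alpha> lam e" and S = "prefix_mats \<alpha> lam e"])
    show "nrm_bound (prefix_mats \<alpha> lam e 0) (word_basis (winner_mat \<alpha> lam e 0) (loser_mat \<alpha> lam e 0)) ((R + 2) ^ 4)"
      by (rule nrm_bound_initial) (use R(1) in linarith)
    show "0 \<le> ?d" by simp
    show "0 \<le> (R + 2) ^ 4" by simp
  qed (use winner_Suc det_winner prefix_mats_Suc tr d in auto)
  have pre: "nrm2 (rmat lam e q) \<le> G" if "prefix q (left_block \<alpha> t) \<or> prefix q (right_block \<alpha> t)" for q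
  proof -
    have "rmat lam e q \<in> prefix_mats \<alpha> lam e t" using that by (auto simp: prefix_mats_def)
    moreover have "mat 1 \<in> word_basis (winner_mat \<alpha> lam e t) (loser_mat \<alpha> lam e t)" by (simp add: word_basis_def)
    ultimately have "nrm2 (rmat lam e q ** mat 1) \<le> G" using bound unfolding nrm_bound_def by blast
    thus ?thesis by simp
  qed
  obtain X Y where XY: "X \<in> {left_block \<alpha> t, right_block \<alpha> t}" "Y \<in> {left_block \<alpha> t, right_block \<alpha> t}"
    "sublist (coding (1 - \<alpha>) \<alpha> p n) (X @ Y)"
    by (rule factor_in_two_blocks[OF \<alpha> p len]) (assumption | rule that)+
  let ?u = "coding (1 - \<alpha>) \<alpha> p n"
  have pre2: "nrm2 (rmat lam e q) \<le> G * G" if q: "prefix q (X @ Y)" for q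
  proof (cases "prefix q X")
    case True
    hence "nrm2 (rmat lam e q) \<le> G * 1" using pre XY(1) by auto
    also have "\<dots> \<le> G * G" using G1 by (intro mult_left_mono) auto
    finally show ?thesis .
  next
    case False
    then obtain q' where q': "q = X @ q'" "prefix q' Y" using q by (auto simp: prefix_append)
    have "nrm2 (rmat lam e q) \<le> nrm2 (rmat lam e q') * nrm2 (rmat lam e X)"
      unfolding q'(1) rmat_append by (rule nrm2_mult)
    also have "\<dots> \<le> G * G" using pre[of q'] pre[of X] q'(2) XY(1,2) G1 nrm2_nonneg by (intro mult_mono) auto
    finally show ?thesis .
  qed
  obtain ps ss where ps: "X @ Y = (ps @ ?u) @ ss" using XY(3) by (auto simp: sublist_def)
  have "rmat lam e ?u = rmat lam e (ps @ ?u) ** adj2 (rmat lam e ps)"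
    using mult_adj2[OF det_rmat, of lam e ps] by (simp add: rmat_append matrix_mul_assoc[symmetric])
  hence "nrm2 (rmat lam e ?u) \<le> nrm2 (rmat lam e (ps @ ?u)) * nrm2 (rmat lam e ps)"
    using nrm2_mult[of "rmat lam e (ps @ ?u)" "adj2 (rmat lam e ps)"] by (simp add: nrm2_adj2)
  also have "\<dots> \<le> (G * G) * (G * G)"
    using pre2[of "ps @ ?u"] pre2[of ps] ps G1 nrm2_nonneg by (intro mult_mono) (auto simp: prefix_def)
  finally show ?thesis unfolding G_def[symmetric] by (simp add: power4_eq_xxxx mult_ac)
qed

text \<open>P to the power log n is n to the power log P; the rounding of m costs the constant
  P^3.\<close>

lemma power_le_powr:
  fixes P :: real
  assumes P: "P \<ge> 1" and n: "n \<ge> 1" and m: "real m \<le> log 2 (real n) + 1"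
  shows "P ^ (2 * m + 1) \<le> P ^ 3 * real n powr (2 * log 2 P)"
proof -
  have "P ^ (2 * m + 1) = P powr (2 * real m + 1)"
    using powr_realpow[of P "2 * m + 1"] P by (simp add: add.commute)
  also have "\<dots> \<le> P powr (3 + 2 * log 2 (real n))" using P m by (intro powr_mono) auto
  also have "\<dots> = P ^ 3 * P powr (2 * log 2 (real n))"
    using P by (simp add: powr_add powr_numeral)
  also have "P powr (2 * log 2 (real n)) = real n powr (2 * log 2 P)"
    using P n by (simp add: powr_def log_def)
  finally show ?thesis .
qed

theorem theorem3:
  fixes \<alpha> lam :: real
  assumes "0 < \<alpha>" "\<alpha> < 1" "\<alpha> \<notin> \<rat>" "bounded_density \<alpha>" "lam \<noteq> 0"
  shows "\<exists>C > 0. \<exists>\<mu> > 0. \<forall>\<theta> \<in> {0..<1}. \<forall>E \<in> sturm_spectrum lam \<alpha>. \<forall>n::nat. n \<ge> 1 \<longrightarrow>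
           mat_opnorm (transfer_word lam E (sturm_word \<alpha> \<theta> n)) \<le> C * real n powr \<mu>"
proof -
  note \<alpha> = assms(1-3)
  \<comment> \<open>Large enough for 3 + lam^2 and, as |e| \<le> 3 + |lam| on the spectrum, for |e|
    + |lam|.\<close>
  define R where "R = 3 + 2 * \<bar>lam\<bar> + lam\<^sup>2"
  define D where "D = (R + 2) ^ 4"
  define B where "B = (1 + 2 * R)\<^sup>2 * (1 + 2 * R + ((2 * R)\<^sup>2 + 4 + lam\<^sup>2))"
  have R3: "R \<ge> 3" by (simp add: R_def)
  have D1: "D \<ge> 1" unfolding D_def using R3 by (intro one_le_power) auto
  have B1: "B \<ge> 1"
  proof -
    have "1 * 1 \<le> B" unfolding B_def using R3 by (intro mult_mono) (auto intro: add_increasing2 add_nonneg_nonneg)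
    thus ?thesis by simp
  qed
  obtain K where K: "\<And>m. \<exists>t \<le> K * (2 * m + 1). \<exists>x y U V. euclid \<alpha> t = (x, y, U, V) \<and> 2 ^ m \<le> length U \<and> 2 ^ m \<le> length V"
    using block_growth[OF assms(1-4)] by blast
  \<comment> \<open>The factor B^t enters to the fourth power with t \<le> K(2m + 1), so P^(2m+1)
    dominates it.\<close>
  define P where "P = B ^ (4 * K)"
  have P1: "P \<ge> 1" unfolding P_def using B1 by (rule one_le_power)
  define C where "C = D ^ 4 * P ^ 3"
  \<comment> \<open>The summand 1 makes the exponent positive even if \<open>P = 1\<close>.\<close>
  define \<mu> where "\<mu> = 2 * log 2 P + 1"
  have C: "C > 0" unfolding C_def using D1 P1 by (intro mult_pos_pos zero_less_power) auto
  have \<mu>: "\<mu> > 0" unfolding \<mu>_def using P1 by (simp add: add_nonneg_pos)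
  have "mat_opnorm (transfer_word lam E (sturm_word \<alpha> \<theta> n)) \<le> C * real n powr \<mu>"
    if E: "E \<in> sturm_spectrum lam \<alpha>" and n: "n \<ge> 1" for \<theta> E n
  proof -
    define e where "e = Re E"
    have Ee: "E = of_real e" unfolding e_def by (rule sturm_spectrum_real[OF E])
    have E': "of_real e \<in> sturm_spectrum lam \<alpha>" using E Ee by simp
    note ne = spectrum_no_escape[OF assms(1-4) E']
    have R: "\<bar>e\<bar> + \<bar>lam\<bar> \<le> R" "3 + lam\<^sup>2 \<le> R" 
      using ne(2) zero_le_power2[of lam] abs_ge_zero[of lam] unfolding R_def by linarith+
    \<comment> \<open>The least m with 2^m \<ge> n, so that both blocks reached for m have length at
      least n.\<close>
    define m where "m = nat \<lceil>log 2 (real n)\<rceil>"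
    have lg: "log 2 (real n) \<ge> 0" using n by simp
    have m: "log 2 (real n) \<le> real m" "real m \<le> log 2 (real n) + 1" unfolding m_def using lg by linarith+
    have "real n = 2 powr log 2 (real n)" using n by simp
    also have "\<dots> \<le> 2 powr real m" using m(1) by (intro powr_mono) auto
    also have "\<dots> = real (2 ^ m)" by (simp add: powr_realpow)
    finally have nm: "n \<le> 2 ^ m" by (simp only: of_nat_le_iff)
    obtain t x y U V where t: "t \<le> K * (2 * m + 1)" "euclid \<alpha> t = (x, y, U, V)" "2 ^ m \<le> length U" "2 ^ m \<le> length V"
      using K[of m] by blast
    have len: "n \<le> length (left_block \<alpha> t)" "n \<le> length (right_block \<alpha> t)"
      using t(2-4) nm by (simp_all add: left_block_def right_block_def)
    let ?p = "frac (\<alpha> + \<theta>)"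
    have "mat_opnorm (transfer_word lam E (sturm_word \<alpha> \<theta> n)) \<le> nrm2 (rmat lam e (coding (1 - \<alpha>) \<alpha> ?p n))"
      unfolding Ee sturm_word_coding[OF \<alpha>(1,2)] by (rule mat_opnorm_real) (rule transfer_word_real)
    also have "\<dots> \<le> (D * B ^ t) ^ 4"
      unfolding D_def B_def by (rule factor_nrm_bound[OF \<alpha> ne(1) R frac_ge_0 frac_lt_1 len])
    also have "\<dots> = D ^ 4 * B ^ (4 * t)" by (simp add: power_mult_distrib power_mult[symmetric] mult.commute)
    also have "\<dots> \<le> D ^ 4 * B ^ (4 * (K * (2 * m + 1)))"
      using t(1) B1 D1 by (intro mult_left_mono power_increasing) auto
    also have "B ^ (4 * (K * (2 * m + 1))) = P ^ (2 * m + 1)"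
      unfolding P_def power_mult[symmetric] by (simp only: mult.assoc)
    also have "D ^ 4 * P ^ (2 * m + 1) \<le> D ^ 4 * (P ^ 3 * real n powr (2 * log 2 P))"
      using D1 by (intro mult_left_mono power_le_powr P1 n m(2)) auto
    also have "\<dots> = C * real n powr (2 * log 2 P)" by (simp add: C_def mult.assoc)
    also have "\<dots> \<le> C * real n powr \<mu>"
      using C n by (intro mult_left_mono powr_mono) (auto simp: \<mu>_def)
    finally show ?thesis .
  qed
  thus ?thesis using C \<mu> by blast
qed

end
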